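(* Let $M^3$ be a 3-dimensional almost cosymplectic (resp. almost Kenmotsu) $(\kappa,\mu,\nu)$-space with $\kappa<0$ (resp. $\kappa<-1$). Then its curvature tensor can be written as $$R=\left(\frac{\tau}{2}-2\kappa\right)R_1+\left(\frac{\tau}{2}-3\kappa\right)R_3+\mu R_4+\nu R_7,$$ where $\tau$ is the scalar curvature of $M$.
   Context: Manifolds, tensor fields and functions are smooth. An almost contact metric manifold $(M,\phi,\xi,\eta,g)$ is an odd-dimensional Riemannian manifold $(M,g)$ with a $(1,1)$-tensor field $\phi$, a vector field $\xi$ and a 1-form $\eta$ such that $\eta(\xi)=1$, $\phi^2X=-X+\eta(X)\xi$ and $g(\phi X,\phi Y)=g(X,Y)-\eta(X)\eta(Y)$. Its fundamental 2-form is $\Phi(X,Y)=g(X,\phi Y)$. It is almost cosymplectic if $d\eta=0$ and $d\Phi=0$; it is almost Kenmotsu if $d\eta=0$ and $d\Phi=2\eta\wedge\Phi$. Put $h=\frac12L_\xi\phi$ ($L$ the Lie derivative) and $R(X,Y)Z=\nabla_X\nabla_YZ-\nabla_Y\nabla_XZ-\nabla_{[X,Y]}Z$, with $\nabla$ the Levi-Civita connection; $\tau=\mathrm{tr}\,Q$ with $Q$ the Ricci operator. A $(\kappa,\mu,\nu)$-space ($\kappa,\mu,\nu$ smooth functions on $M$) is an almost contact metric manifold satisfying, for all $X,Y$, $$R(X,Y)\xi=\kappa\{\eta(Y)X-\eta(X)Y\}+\mu\{\eta(Y)hX-\eta(X)hY\}+\nu\{\eta(Y)\phi hX-\eta(X)\phi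 hY\}.$$ The tensors are, for all vector fields $X,Y,Z$: $R_1(X,Y)Z=g(Y,Z)X-g(X,Z)Y$; $R_3(X,Y)Z=\eta(X)\eta(Z)Y-\eta(Y)\eta(Z)X+g(X,Z)\eta(Y)\xi-g(Y,Z)\eta(X)\xi$; $R_4(X,Y)Z=g(Y,Z)hX-g(X,Z)hY+g(hY,Z)X-g(hX,Z)Y$; $R_7(X,Y)Z=g(Y,Z)\phi hX-g(X,Z)\phi hY+g(\phi hY,Z)X-g(\phi hX,Z)Y$. *)

theory Defs
  imports "HOL-Analysis.Analysis" "HOL-Library.Function_Algebras"
begin

section \<open>Functions as a real vector space\<close>

instantiation "fun" :: (type, real_vector) real_vector
begin

definition scaleR_fun :: "real \<Rightarrow> ('a \<Rightarrow> 'b) \<Rightarrow> 'a \<Rightarrow> 'b"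
  where "scaleR_fun c f = (\<lambda>x. c *\<^sub>R f x)"

instance
  by standard (auto simp: scaleR_fun_def fun_eq_iff scaleR_add_right scaleR_add_left)

end

section \<open>Smooth manifolds\<close>

text \<open>\<^term>\<open>Ck_on\<close> and \<^term>\<open>smooth_on\<close> are meant for open sets only: derivatives are taken
  with respect to full neighbourhoods.\<close>

primrec Ck_on :: "nat \<Rightarrow> 'a::real_normed_vector set \<Rightarrow> ('a \<Rightarrow> 'b::real_normed_vector) \<Rightarrow> bool"
where
  "Ck_on 0 S f \<longleftrightarrow> continuous_on S f"
| "Ck_on (Suc k) S f \<longleftrightarrow>
     (\<forall>x\<in>S. f differentiable (at x)) \<and> (\<forall>v. Ck_on k S (\<lambda>x. frechet_derivative f (at x) v))"

definition smooth_on :: "'a::real_normed_vector set \<Rightarrow> ('a \<Rightarrow> 'b::real_normed_vector) \<Rightarrow> bool"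
  where "smooth_on S f \<longleftrightarrow> (\<forall>k. Ck_on k S f)"

text \<open>The manifold is the whole type \<open>'m\<close>, which is Hausdorff and second countable, and its smooth
  structure is given by a (not necessarily maximal) atlas. A chart is a pair of an open domain and a
  coordinate map into the model space \<open>'e\<close>, so that the dimension is \<^term>\<open>DIM('e::euclidean_space)\<close>.\<close>

type_synonym ('m, 'e) chart = "'m set \<times> ('m \<Rightarrow> 'e)"

definition smooth_atlas ::
    "('m::{t2_space,second_countable_topology}, 'e::euclidean_space) chart set \<Rightarrow> bool"
  where "smooth_atlas A \<longleftrightarrow>
    (\<Union>(U, c)\<in>A. U) = UNIV \<and>
    (\<forall>(U, c)\<in>A. open U \<and> open (c ` U) \<and> homeomorphism U (c ` U) c (inv_into U c)) \<and>
    (\<forall>(U, c)\<in>A. \<forall>(V, d)\<in>A. smooth_on (c ` (U \<inter> V)) (d \<circ> inv_into U c))"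

definition smooth_fun :: "('m, 'e::euclidean_space) chart set \<Rightarrow> ('m \<Rightarrow> real) \<Rightarrow> bool"
  where "smooth_fun A f \<longleftrightarrow> (\<forall>(U, c)\<in>A. smooth_on (c ` U) (f \<circ> inv_into U c))"

section \<open>Tangent vectors, vector fields and tensor fields\<close>

text \<open>A tangent vector at \<open>p\<close> is a derivation at \<open>p\<close> of the algebra of smooth functions. It is
  normalised to be zero on functions that are not smooth, so that equality of functionals is
  equality of tangent vectors.\<close>

type_synonym 'm tvec = "('m \<Rightarrow> real) \<Rightarrow> real"
type_synonym 'm vfield = "'m \<Rightarrow> 'm tvec"
type_synonym 'm form1 = "'m \<Rightarrow> 'm tvec \<Rightarrow> real"
type_synonym 'm form2 = "'m \<Rightarrow> 'm tvec \<Rightarrow> 'm tvec \<Rightarrow> real"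
type_synonym 'm endo = "'m \<Rightarrow> 'm tvec \<Rightarrow> 'm tvec"

definition tangent_space :: "('m, 'e::euclidean_space) chart set \<Rightarrow> 'm \<Rightarrow> 'm tvec set"
  where "tangent_space A p = {v.
    (\<forall>f. \<not> smooth_fun A f \<longrightarrow> v f = 0) \<and>
    (\<forall>f g. \<forall>a b :: real. smooth_fun A f \<longrightarrow> smooth_fun A g \<longrightarrow>
       v (\<lambda>x. a * f x + b * g x) = a * v f + b * v g) \<and>
    (\<forall>f g. smooth_fun A f \<longrightarrow> smooth_fun A g \<longrightarrow>
       v (\<lambda>x. f x * g x) = f p * v g + g p * v f)}"

definition deriv_along :: "'m vfield \<Rightarrow> ('m \<Rightarrow> real) \<Rightarrow> 'm \<Rightarrow> real"
  where "deriv_along X f = (\<lambda>p. X p f)"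

definition vector_fields :: "('m, 'e::euclidean_space) chart set \<Rightarrow> 'm vfield set"
  where "vector_fields A = {X.
    (\<forall>p. X p \<in> tangent_space A p) \<and>
    (\<forall>f. smooth_fun A f \<longrightarrow> smooth_fun A (deriv_along X f))}"

definition fscale :: "('m \<Rightarrow> real) \<Rightarrow> 'm vfield \<Rightarrow> 'm vfield"  (infixr \<open>\<odot>\<close> 75)
  where "f \<odot> X = (\<lambda>p. f p *\<^sub>R X p)"

definition form1_app :: "'m form1 \<Rightarrow> 'm vfield \<Rightarrow> 'm \<Rightarrow> real"
  where "form1_app \<alpha> X = (\<lambda>p. \<alpha> p (X p))"

definition form2_app :: "'m form2 \<Rightarrow> 'm vfield \<Rightarrow> 'm vfield \<Rightarrow> 'm \<Rightarrow> real"
  where "form2_app \<omega> X Y = (\<lambda>p. \<omega> p (X p) (Y p))"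

definition endo_app :: "'m endo \<Rightarrow> 'm vfield \<Rightarrow> 'm vfield"
  where "endo_app \<phi> X = (\<lambda>p. \<phi> p (X p))"

definition linear_on_space :: "'a::real_vector set \<Rightarrow> ('a \<Rightarrow> 'b::real_vector) \<Rightarrow> bool"
  where "linear_on_space V L \<longleftrightarrow>
    (\<forall>u\<in>V. \<forall>v\<in>V. \<forall>a b. L (a *\<^sub>R u + b *\<^sub>R v) = a *\<^sub>R L u + b *\<^sub>R L v)"

definition one_form :: "('m, 'e::euclidean_space) chart set \<Rightarrow> 'm form1 \<Rightarrow> bool"
  where "one_form A \<alpha> \<longleftrightarrow>
    (\<forall>p. linear_on_space (tangent_space A p) (\<alpha> p)) \<and>
    (\<forall>X\<in>vector_fields A. smooth_fun A (form1_app \<alpha> X))"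

definition endomorphism_field :: "('m, 'e::euclidean_space) chart set \<Rightarrow> 'm endo \<Rightarrow> bool"
  where "endomorphism_field A \<phi> \<longleftrightarrow>
    (\<forall>p. linear_on_space (tangent_space A p) (\<phi> p) \<and>
         \<phi> p ` tangent_space A p \<subseteq> tangent_space A p) \<and>
    (\<forall>X\<in>vector_fields A. endo_app \<phi> X \<in> vector_fields A)"

definition riemannian_metric :: "('m, 'e::euclidean_space) chart set \<Rightarrow> 'm form2 \<Rightarrow> bool"
  where "riemannian_metric A g \<longleftrightarrow>
    (\<forall>p. \<forall>u\<in>tangent_space A p.
       linear_on_space (tangent_space A p) (g p u) \<and>
       (\<forall>v\<in>tangent_space A p. g p u v = g p v u) \<and>
       (u \<noteq> 0 \<longrightarrow> g p u u > 0)) \<and>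
    (\<forall>X\<in>vector_fields A. \<forall>Y\<in>vector_fields A. smooth_fun A (form2_app g X Y))"

text \<open>The second argument of \<open>X p\<close> below is the smooth function \<open>Y f\<close>; if \<open>f\<close> is not smooth, both
  terms vanish by the normalisation of tangent vectors.\<close>

definition lie_bracket :: "'m vfield \<Rightarrow> 'm vfield \<Rightarrow> 'm vfield"
  where "lie_bracket X Y = (\<lambda>p f. X p (deriv_along Y f) - Y p (deriv_along X f))"

definition lie_deriv_endo :: "'m vfield \<Rightarrow> 'm endo \<Rightarrow> 'm vfield \<Rightarrow> 'm vfield"
  where "lie_deriv_endo X \<phi> Y = lie_bracket X (endo_app \<phi> Y) - endo_app \<phi> (lie_bracket X Y)"

text \<open>Exterior derivatives and the wedge product are normalised without the factors \<open>1/2\<close> and \<open>1/3\<close>.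
  With the other common normalisation both sides of \<open>d\<Phi> = 2 \<eta> \<and> \<Phi>\<close> are multiplied by \<open>1/3\<close>, so
  the conditions used below do not depend on this choice.\<close>

definition ext_deriv1 :: "'m form1 \<Rightarrow> 'm vfield \<Rightarrow> 'm vfield \<Rightarrow> 'm \<Rightarrow> real"
  where "ext_deriv1 \<alpha> X Y =
    deriv_along X (form1_app \<alpha> Y) - deriv_along Y (form1_app \<alpha> X) - form1_app \<alpha> (lie_bracket X Y)"

definition ext_deriv2 :: "'m form2 \<Rightarrow> 'm vfield \<Rightarrow> 'm vfield \<Rightarrow> 'm vfield \<Rightarrow> 'm \<Rightarrow> real"
  where "ext_deriv2 \<omega> X Y Z =
    deriv_along X (form2_app \<omega> Y Z) + deriv_along Y (form2_app \<omega> Z X)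
      + deriv_along Z (form2_app \<omega> X Y)
      - form2_app \<omega> (lie_bracket X Y) Z - form2_app \<omega> (lie_bracket Y Z) X
      - form2_app \<omega> (lie_bracket Z X) Y"

definition wedge12 :: "'m form1 \<Rightarrow> 'm form2 \<Rightarrow> 'm vfield \<Rightarrow> 'm vfield \<Rightarrow> 'm vfield \<Rightarrow> 'm \<Rightarrow> real"
  where "wedge12 \<alpha> \<omega> X Y Z = (\<lambda>p.
    form1_app \<alpha> X p * form2_app \<omega> Y Z p + form1_app \<alpha> Y p * form2_app \<omega> Z X p
      + form1_app \<alpha> Z p * form2_app \<omega> X Y p)"

section \<open>Levi-Civita connection and curvature\<close>

definition affine_connection ::
    "('m, 'e::euclidean_space) chart set \<Rightarrow> ('m vfield \<Rightarrow> 'm vfield \<Rightarrow> 'm vfield) \<Rightarrow> bool"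
  where "affine_connection A D \<longleftrightarrow>
    (\<forall>X\<in>vector_fields A. \<forall>Y\<in>vector_fields A. D X Y \<in> vector_fields A) \<and>
    (\<forall>X\<in>vector_fields A. \<forall>Y\<in>vector_fields A. \<forall>Z\<in>vector_fields A. \<forall>f.
       smooth_fun A f \<longrightarrow>
         D (X + Y) Z = D X Z + D Y Z \<and>
         D (f \<odot> X) Z = f \<odot> D X Z \<and>
         D X (Y + Z) = D X Y + D X Z \<and>
         D X (f \<odot> Y) = deriv_along X f \<odot> Y + f \<odot> D X Y)"

definition levi_civita ::
    "('m, 'e::euclidean_space) chart set \<Rightarrow> 'm form2 \<Rightarrow> ('m vfield \<Rightarrow> 'm vfield \<Rightarrow> 'm vfield) \<Rightarrow> bool"
  where "levi_civita A g D \<longleftrightarrow>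
    affine_connection A D \<and>
    (\<forall>X\<in>vector_fields A. \<forall>Y\<in>vector_fields A. D X Y - D Y X = lie_bracket X Y) \<and>
    (\<forall>X\<in>vector_fields A. \<forall>Y\<in>vector_fields A. \<forall>Z\<in>vector_fields A.
       deriv_along X (form2_app g Y Z) = form2_app g (D X Y) Z + form2_app g Y (D X Z))"

definition curvature ::
    "('m vfield \<Rightarrow> 'm vfield \<Rightarrow> 'm vfield) \<Rightarrow> 'm vfield \<Rightarrow> 'm vfield \<Rightarrow> 'm vfield \<Rightarrow> 'm vfield"
  where "curvature D X Y Z = D X (D Y Z) - D Y (D X Z) - D (lie_bracket X Y) Z"

text \<open>Every tangent vector extends to a smooth vector field, and the curvature is tensorial, so its
  value at a point does not depend on the chosen extensions.\<close>

definition extend_tvec :: "('m, 'e::euclidean_space) chart set \<Rightarrow> 'm \<Rightarrow> 'm tvec \<Rightarrow> 'm vfield"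
  where "extend_tvec A p v = (SOME X. X \<in> vector_fields A \<and> X p = v)"

definition curvature_at ::
    "('m, 'e::euclidean_space) chart set \<Rightarrow> ('m vfield \<Rightarrow> 'm vfield \<Rightarrow> 'm vfield) \<Rightarrow> 'm \<Rightarrow>
      'm tvec \<Rightarrow> 'm tvec \<Rightarrow> 'm tvec \<Rightarrow> 'm tvec"
  where "curvature_at A D p u v w =
    curvature D (extend_tvec A p u) (extend_tvec A p v) (extend_tvec A p w) p"

definition trace_on :: "'a::real_vector set \<Rightarrow> ('a \<Rightarrow> 'a) \<Rightarrow> real"
  where "trace_on V L =
    (let B = (SOME B. independent B \<and> span B = V) in \<Sum>b\<in>B. representation B (L b) b)"

definition ricci_at ::
    "('m, 'e::euclidean_space) chart set \<Rightarrow> ('m vfield \<Rightarrow> 'm vfield \<Rightarrow> 'm vfield) \<Rightarrow> 'm form2"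
  where "ricci_at A D p v w = trace_on (tangent_space A p) (\<lambda>u. curvature_at A D p u v w)"

definition ricci_operator ::
    "('m, 'e::euclidean_space) chart set \<Rightarrow> 'm form2 \<Rightarrow>
      ('m vfield \<Rightarrow> 'm vfield \<Rightarrow> 'm vfield) \<Rightarrow> 'm endo"
  where "ricci_operator A g D p v =
    (THE q. q \<in> tangent_space A p \<and> (\<forall>w\<in>tangent_space A p. g p q w = ricci_at A D p v w))"

definition scalar_curvature ::
    "('m, 'e::euclidean_space) chart set \<Rightarrow> 'm form2 \<Rightarrow>
      ('m vfield \<Rightarrow> 'm vfield \<Rightarrow> 'm vfield) \<Rightarrow> 'm \<Rightarrow> real"
  where "scalar_curvature A g D p = trace_on (tangent_space A p) (ricci_operator A g D p)"

section \<open>Almost contact metric manifolds\<close>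

definition almost_contact_metric ::
    "('m::{t2_space,second_countable_topology}, 'e::euclidean_space) chart set \<Rightarrow>
      'm endo \<Rightarrow> 'm vfield \<Rightarrow> 'm form1 \<Rightarrow> 'm form2 \<Rightarrow> bool"
  where "almost_contact_metric A \<phi> \<xi> \<eta> g \<longleftrightarrow>
    smooth_atlas A \<and> odd DIM('e) \<and> riemannian_metric A g \<and>
    endomorphism_field A \<phi> \<and> \<xi> \<in> vector_fields A \<and> one_form A \<eta> \<and>
    (\<forall>p. \<eta> p (\<xi> p) = 1) \<and>
    (\<forall>p. \<forall>u\<in>tangent_space A p. \<phi> p (\<phi> p u) = - u + \<eta> p u *\<^sub>R \<xi> p) \<and>
    (\<forall>p. \<forall>u\<in>tangent_space A p. \<forall>v\<in>tangent_space A p.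
       g p (\<phi> p u) (\<phi> p v) = g p u v - \<eta> p u * \<eta> p v)"

definition fundamental_form :: "'m endo \<Rightarrow> 'm form2 \<Rightarrow> 'm form2"
  where "fundamental_form \<phi> g = (\<lambda>p u v. g p u (\<phi> p v))"

definition almost_cosymplectic ::
    "('m::{t2_space,second_countable_topology}, 'e::euclidean_space) chart set \<Rightarrow>
      'm endo \<Rightarrow> 'm vfield \<Rightarrow> 'm form1 \<Rightarrow> 'm form2 \<Rightarrow> bool"
  where "almost_cosymplectic A \<phi> \<xi> \<eta> g \<longleftrightarrow>
    almost_contact_metric A \<phi> \<xi> \<eta> g \<and>
    (\<forall>X\<in>vector_fields A. \<forall>Y\<in>vector_fields A. ext_deriv1 \<eta> X Y = (\<lambda>p. 0)) \<and>
    (\<forall>X\<in>vector_fields A. \<forall>Y\<in>vector_fields A. \<forall>Z\<in>vector_fields A.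
       ext_deriv2 (fundamental_form \<phi> g) X Y Z = (\<lambda>p. 0))"

definition almost_kenmotsu ::
    "('m::{t2_space,second_countable_topology}, 'e::euclidean_space) chart set \<Rightarrow>
      'm endo \<Rightarrow> 'm vfield \<Rightarrow> 'm form1 \<Rightarrow> 'm form2 \<Rightarrow> bool"
  where "almost_kenmotsu A \<phi> \<xi> \<eta> g \<longleftrightarrow>
    almost_contact_metric A \<phi> \<xi> \<eta> g \<and>
    (\<forall>X\<in>vector_fields A. \<forall>Y\<in>vector_fields A. ext_deriv1 \<eta> X Y = (\<lambda>p. 0)) \<and>
    (\<forall>X\<in>vector_fields A. \<forall>Y\<in>vector_fields A. \<forall>Z\<in>vector_fields A.
       ext_deriv2 (fundamental_form \<phi> g) X Y Z
         = (\<lambda>p. 2 * wedge12 \<eta> (fundamental_form \<phi> g) X Y Z p))"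

definition h_tensor :: "'m endo \<Rightarrow> 'm vfield \<Rightarrow> 'm vfield \<Rightarrow> 'm vfield"
  where "h_tensor \<phi> \<xi> X = (1/2) *\<^sub>R lie_deriv_endo \<xi> \<phi> X"

definition kmn_space ::
    "('m::{t2_space,second_countable_topology}, 'e::euclidean_space) chart set \<Rightarrow>
      'm endo \<Rightarrow> 'm vfield \<Rightarrow> 'm form1 \<Rightarrow> 'm form2 \<Rightarrow>
      ('m vfield \<Rightarrow> 'm vfield \<Rightarrow> 'm vfield) \<Rightarrow>
      ('m \<Rightarrow> real) \<Rightarrow> ('m \<Rightarrow> real) \<Rightarrow> ('m \<Rightarrow> real) \<Rightarrow> bool"
  where "kmn_space A \<phi> \<xi> \<eta> g D \<kappa> \<mu> \<nu> \<longleftrightarrow>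
    almost_contact_metric A \<phi> \<xi> \<eta> g \<and> levi_civita A g D \<and>
    smooth_fun A \<kappa> \<and> smooth_fun A \<mu> \<and> smooth_fun A \<nu> \<and>
    (\<forall>X\<in>vector_fields A. \<forall>Y\<in>vector_fields A.
       let h = h_tensor \<phi> \<xi>; \<phi>h = (\<lambda>W. endo_app \<phi> (h_tensor \<phi> \<xi> W)) in
       curvature D X Y \<xi> =
         \<kappa> \<odot> (form1_app \<eta> Y \<odot> X - form1_app \<eta> X \<odot> Y)
         + \<mu> \<odot> (form1_app \<eta> Y \<odot> h X - form1_app \<eta> X \<odot> h Y)
         + \<nu> \<odot> (form1_app \<eta> Y \<odot> \<phi>h X - form1_app \<eta> X \<odot> \<phi>h Y))"

definition R1 :: "'m form2 \<Rightarrow> 'm vfield \<Rightarrow> 'm vfield \<Rightarrow> 'm vfield \<Rightarrow> 'm vfield"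
  where "R1 g X Y Z = form2_app g Y Z \<odot> X - form2_app g X Z \<odot> Y"

definition R3 ::
    "'m vfield \<Rightarrow> 'm form1 \<Rightarrow> 'm form2 \<Rightarrow> 'm vfield \<Rightarrow> 'm vfield \<Rightarrow> 'm vfield \<Rightarrow> 'm vfield"
  where "R3 \<xi> \<eta> g X Y Z =
    form1_app \<eta> X \<odot> form1_app \<eta> Z \<odot> Y - form1_app \<eta> Y \<odot> form1_app \<eta> Z \<odot> X
    + form2_app g X Z \<odot> form1_app \<eta> Y \<odot> \<xi> - form2_app g Y Z \<odot> form1_app \<eta> X \<odot> \<xi>"

definition R4 ::
    "'m endo \<Rightarrow> 'm vfield \<Rightarrow> 'm form2 \<Rightarrow> 'm vfield \<Rightarrow> 'm vfield \<Rightarrow> 'm vfield \<Rightarrow> 'm vfield"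
  where "R4 \<phi> \<xi> g X Y Z =
    (let h = h_tensor \<phi> \<xi> in
      form2_app g Y Z \<odot> h X - form2_app g X Z \<odot> h Y
      + form2_app g (h Y) Z \<odot> X - form2_app g (h X) Z \<odot> Y)"

definition R7 ::
    "'m endo \<Rightarrow> 'm vfield \<Rightarrow> 'm form2 \<Rightarrow> 'm vfield \<Rightarrow> 'm vfield \<Rightarrow> 'm vfield \<Rightarrow> 'm vfield"
  where "R7 \<phi> \<xi> g X Y Z =
    (let \<phi>h = (\<lambda>W. endo_app \<phi> (h_tensor \<phi> \<xi> W)) in
      form2_app g Y Z \<odot> \<phi>h X - form2_app g X Z \<odot> \<phi>h Y
      + form2_app g (\<phi>h Y) Z \<odot> X - form2_app g (\<phi>h X) Z \<odot> Y)"

end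

theory Submission
  imports Defs
begin

text \<open>
  In dimension three, the curvature tensor at a point is determined by the Jacobi operator
  \<open>T X = R(X, \<xi>)\<xi>\<close> together with one more number, the sectional curvature \<open>K\<close> of the plane orthogonal
  to \<open>\<xi>\<close>, once \<open>R(X, Y)\<xi> = \<eta>(Y) T X - \<eta>(X) T Y\<close>. In a \<open>(\<kappa>,\<mu>,\<nu>)\<close>-space the latter holds with
  \<open>T X = \<kappa> (X - \<eta>(X)\<xi>) + P X\<close> and \<open>P = \<mu> h + \<nu> \<phi>h\<close>, because \<open>h \<xi> = 0\<close>. The claimed right-hand side is
  algebraically a curvature tensor: it is the Kulkarni-Nomizu product of \<open>g\<close> with a symmetric form. So it
  suffices to compare it with \<open>R\<close> on arguments involving \<open>\<xi>\<close>, where both agree identically, and on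
  the plane orthogonal to \<open>\<xi>\<close>. This comparison is \<open>curvature_form_dim3\<close>.

  The comparison on the plane amounts to \<open>K = \<tau>/2 - 2\<kappa>\<close>. Expanding the scalar curvature in an
  orthonormal basis \<open>e, \<phi>e, \<xi>\<close> gives \<open>\<tau> = 2K + 2 tr T\<close>, and \<open>tr T = 2\<kappa>\<close> as \<open>P\<close> is trace free. The
  last fact comes from \<open>d\<eta> = 0\<close>, which is part of both structures: it makes \<open>\<eta>\<close>
  invariant along \<open>\<xi>\<close>, so that the Lie derivative of \<open>\<phi>\<^sup>2 = -1 + \<eta>\<otimes>\<xi>\<close> vanishes. Thus \<open>h\<close> and \<open>\<phi>h\<close>
  anticommute with \<open>\<phi>\<close> and their diagonal entries at \<open>e\<close> and \<open>\<phi>e\<close> cancel (\<open>h_phi\<close>, \<open>trace_h\<close>). The symmetry of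
  \<open>P\<close>, hence of the form just mentioned, is inherited from the pair symmetry of \<open>R\<close> through \<open>T\<close>.

  What remains is the passage between vector fields and points. Tangent vectors are derivations of the
  algebra of smooth functions, and the scalar curvature is a trace over the space of these, evaluated on
  extensions to vector fields. By \<open>local_frame\<close>, which combines a bump function with Hadamard's lemma, this
  space has the dimension of the model space, its elements extend to vector fields, and operators
  linear over the smooth functions act pointwise (\<open>tensorial_at\<close>). The symmetries of \<open>R\<close> are then
  proved for vector fields from the axioms of the Levi-Civita connection and read off at each point.
\<close>

section \<open>Smooth functions on open sets\<close>

lemma Ck_on_cong:
  assumes "open S" "\<And>x. x \<in> S \<Longrightarrow> f x = g x" "Ck_on k S f"
  shows "Ck_on k S g"
  using assms(2,3)
proof (induction k arbitrary: f g)
  case 0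
  then show ?case using continuous_on_eq by (metis Ck_on.simps(1))
next
  case (Suc k)
  have "g differentiable (at x)" if "x \<in> S" for x
  proof -
    have "f differentiable (at x)" using Suc.prems(2) that by simp
    then obtain f' where "(f has_derivative f') (at x)" unfolding differentiable_def ..
    then have "(g has_derivative f') (at x)"
      using assms(1) that Suc.prems(1) by (rule has_derivative_transform_within_open)
    then show ?thesis by (rule differentiableI)
  qed
  moreover have "Ck_on k S (\<lambda>x. frechet_derivative g (at x) v)" for v
  proof (rule Suc.IH)
    show "Ck_on k S (\<lambda>x. frechet_derivative f (at x) v)" using Suc.prems by simp
    show "frechet_derivative f (at x) v = frechet_derivative g (at x) v" if "x \<in> S" for x
      using frechet_derivative_transform_within_open[of f x S g] Suc.prems that assms(1) by auto
  qed
  ultimately show ?case by simp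
qed

lemma Ck_on_locally:
  assumes "\<And>x. x \<in> S \<Longrightarrow> \<exists>T. open T \<and> x \<in> T \<and> Ck_on k T f"
  shows "Ck_on k S f"
  using assms
proof (induction k arbitrary: f)
  case 0
  have "isCont f x" if "x \<in> S" for x
    using 0[OF that] continuous_on_eq_continuous_at by auto
  then show ?case by (simp add: continuous_at_imp_continuous_on)
next
  case (Suc k)
  have "f differentiable (at x)" if "x \<in> S" for x
    using Suc.prems[OF that] by auto
  moreover have "Ck_on k S (\<lambda>x. frechet_derivative f (at x) v)" for v
    by (rule Suc.IH) (use Suc.prems in fastforce)
  ultimately show ?case by simp
qed

lemma Ck_on_subset: "Ck_on k S f \<Longrightarrow> T \<subseteq> S \<Longrightarrow> Ck_on k T f"
  by (induction k arbitrary: f) (auto intro: continuous_on_subset)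

lemma Ck_on_Suc_imp: "Ck_on (Suc k) S f \<Longrightarrow> Ck_on k S f"
proof (induction k arbitrary: f)
  case 0
  then show ?case
    by (auto intro!: continuous_at_imp_continuous_on differentiable_imp_continuous_within)
next
  case (Suc k)
  then show ?case by (metis Ck_on.simps(2))
qed

text \<open>The recursive definition speaks of \<^const>\<open>frechet_derivative\<close>; exhibiting any derivative is
  enough. This is how closure properties are proved by induction: the directional derivatives of the
  composite are composites of the same kind, of one order less.\<close>

lemma Ck_on_SucI:
  assumes "open S"
    and "\<And>x. x \<in> S \<Longrightarrow> (f has_derivative f' x) (at x)"
    and "\<And>v. Ck_on k S (\<lambda>x. f' x v)"
  shows "Ck_on (Suc k) S f"
proof -
  have "Ck_on k S (\<lambda>x. frechet_derivative f (at x) v)" for v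
    by (rule Ck_on_cong[OF assms(1) _ assms(3)[of v]])
      (metis assms(2) frechet_derivative_at)
  then show ?thesis using assms(2) by (auto simp: differentiable_def)
qed

lemma Ck_on_const: "open S \<Longrightarrow> Ck_on k S (\<lambda>x. c)"
proof (induction k arbitrary: c)
  case (Suc k)
  show ?case by (rule Ck_on_SucI[where f' = "\<lambda>x v. 0"]) (use Suc in auto)
qed simp

lemma Ck_on_bounded_linear:
  assumes "open S" "bounded_linear L" "Ck_on k S f"
  shows "Ck_on k S (\<lambda>x. L (f x))"
  using assms(3)
proof (induction k arbitrary: f)
  case 0
  then show ?case using assms(2) by (simp add: linear_continuous_on_compose bounded_linear.continuous_on)
next
  case (Suc k)
  show ?case
  proof (rule Ck_on_SucI[where f' = "\<lambda>x v. L (frechet_derivative f (at x) v)", OF assms(1)])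
    show "((\<lambda>x. L (f x)) has_derivative (\<lambda>v. L (frechet_derivative f (at x) v))) (at x)"
      if "x \<in> S" for x
      using Suc.prems that
      by (auto intro!: bounded_linear.has_derivative[OF assms(2)] simp flip: frechet_derivative_works)
  qed (use Suc in auto)
qed

lemma Ck_on_ident: "open S \<Longrightarrow> Ck_on k S (\<lambda>x. x)"
proof (cases k)
  case (Suc j)
  assume "open S"
  then show ?thesis unfolding Suc
    by (intro Ck_on_SucI[where f' = "\<lambda>x v. v"] Ck_on_const) auto
qed simp

lemma Ck_on_add:
  assumes "open S" "Ck_on k S f" "Ck_on k S g"
  shows "Ck_on k S (\<lambda>x. f x + g x)"
  using assms(2,3)
proof (induction k arbitrary: f g)
  case 0
  then show ?case by (auto intro: continuous_on_add)
next
  case (Suc k)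
  show ?case
  proof (rule Ck_on_SucI[where f' = "\<lambda>x v. frechet_derivative f (at x) v + frechet_derivative g (at x) v", OF assms(1)])
    show "((\<lambda>x. f x + g x) has_derivative (\<lambda>v. frechet_derivative f (at x) v + frechet_derivative g (at x) v)) (at x)"
      if "x \<in> S" for x
      using Suc.prems that
      by (auto intro!: has_derivative_add simp flip: frechet_derivative_works)
  qed (use Suc in auto)
qed

lemma Ck_on_mult:
  fixes f g :: "'a::real_normed_vector \<Rightarrow> real"
  assumes "open S" "Ck_on k S f" "Ck_on k S g"
  shows "Ck_on k S (\<lambda>x. f x * g x)"
  using assms(2,3)
proof (induction k arbitrary: f g)
  case 0
  then show ?case by (auto intro: continuous_on_mult)
next
  case (Suc k)
  let ?d = "\<lambda>x v. f x * frechet_derivative g (at x) v + frechet_derivative f (at x) v * g x"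
  show ?case
  proof (rule Ck_on_SucI[where f' = ?d, OF assms(1)])
    show "((\<lambda>x. f x * g x) has_derivative ?d x) (at x)" if "x \<in> S" for x
      using Suc.prems that
      by (auto intro!: has_derivative_mult simp flip: frechet_derivative_works)
    show "Ck_on k S (\<lambda>x. ?d x v)" for v
      using Suc.prems Suc.prems[THEN Ck_on_Suc_imp]
      by (intro Ck_on_add[OF assms(1)] Suc.IH) auto
  qed
qed

lemma Ck_on_sum:
  assumes "open S" "\<And>i. i \<in> I \<Longrightarrow> Ck_on k S (f i)"
  shows "Ck_on k S (\<lambda>x. \<Sum>i\<in>I. f i x)"
proof (cases "finite I")
  case True
  then show ?thesis using assms(2)
    by (induction I) (auto intro: Ck_on_const[OF assms(1)] Ck_on_add[OF assms(1)])
qed (simp add: Ck_on_const[OF assms(1)])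

text \<open>In the chain rule the direction itself varies with the point. Expanding it in a basis separates
  the two dependences, which makes the induction in \<open>Ck_on_compose\<close> possible.\<close>

lemma frechet_derivative_components:
  fixes f :: "'b::euclidean_space \<Rightarrow> real"
  assumes "f differentiable (at x)"
  shows "frechet_derivative f (at x) v = (\<Sum>b\<in>Basis. (v \<bullet> b) * frechet_derivative f (at x) b)"
proof -
  have l: "linear (frechet_derivative f (at x))" by (rule linear_frechet_derivative[OF assms])
  have "frechet_derivative f (at x) v = frechet_derivative f (at x) (\<Sum>b\<in>Basis. (v \<bullet> b) *\<^sub>R b)"
    by (simp add: euclidean_representation)
  also have "\<dots> = (\<Sum>b\<in>Basis. (v \<bullet> b) * frechet_derivative f (at x) b)"
    using l by (simp add: linear_sum linear_cmul)
  finally show ?thesis .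
qed

lemma Ck_on_compose:
  fixes f :: "'b::euclidean_space \<Rightarrow> real" and c :: "'a::real_normed_vector \<Rightarrow> 'b"
  assumes "open S" "c ` S \<subseteq> T" "Ck_on k T f" "Ck_on k S c"
  shows "Ck_on k S (\<lambda>x. f (c x))"
  using assms(3,4)
proof (induction k arbitrary: f)
  case 0
  then show ?case using assms(2) continuous_on_compose2 by (fastforce)
next
  case (Suc k)
  let ?d = "\<lambda>x v. \<Sum>b\<in>Basis. (frechet_derivative c (at x) v \<bullet> b) * frechet_derivative f (at (c x)) b"
  show ?case
  proof (rule Ck_on_SucI[where f' = ?d, OF assms(1)])
    show "((\<lambda>x. f (c x)) has_derivative ?d x) (at x)" if "x \<in> S" for x
    proof -
      have df: "f differentiable (at (c x))" and dc: "c differentiable (at x)"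
        using Suc.prems that assms(2) by auto
      have "((\<lambda>x. f (c x)) has_derivative
          (\<lambda>v. frechet_derivative f (at (c x)) (frechet_derivative c (at x) v))) (at x)"
        using df dc unfolding frechet_derivative_works by (rule has_derivative_compose[rotated])
      then show ?thesis by (subst (asm) frechet_derivative_components[OF df])
    qed
    show "Ck_on k S (\<lambda>x. ?d x v)" for v
      using Suc.prems Suc.prems(2)[THEN Ck_on_Suc_imp]
      by (intro Ck_on_sum Ck_on_mult assms(1) Suc.IH
           Ck_on_bounded_linear[OF assms(1) bounded_linear_inner_left]) auto
  qed
qed

lemma smooth_on_cong:
  "open S \<Longrightarrow> (\<And>x. x \<in> S \<Longrightarrow> f x = g x) \<Longrightarrow> smooth_on S f \<Longrightarrow> smooth_on S g"
  unfolding smooth_on_def using Ck_on_cong by blast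

lemma smooth_on_subset: "smooth_on S f \<Longrightarrow> T \<subseteq> S \<Longrightarrow> smooth_on T f"
  unfolding smooth_on_def using Ck_on_subset by blast

lemma smooth_on_locally:
  "(\<And>x. x \<in> S \<Longrightarrow> \<exists>T. open T \<and> x \<in> T \<and> smooth_on T f) \<Longrightarrow> smooth_on S f"
  unfolding smooth_on_def by (meson Ck_on_locally)

lemma smooth_on_const: "open S \<Longrightarrow> smooth_on S (\<lambda>x. c)"
  by (simp add: smooth_on_def Ck_on_const)

lemma smooth_on_inner: "open S \<Longrightarrow> smooth_on S (\<lambda>x. x \<bullet> b)"
  unfolding smooth_on_def
  by (auto intro: Ck_on_bounded_linear[OF _ bounded_linear_inner_left Ck_on_ident])

lemma smooth_on_add:
  "open S \<Longrightarrow> smooth_on S f \<Longrightarrow> smooth_on S g \<Longrightarrow> smooth_on S (\<lambda>x. f x + g x)"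
  by (simp add: smooth_on_def Ck_on_add)

lemma smooth_on_mult:
  fixes f g :: "'a::real_normed_vector \<Rightarrow> real"
  shows "open S \<Longrightarrow> smooth_on S f \<Longrightarrow> smooth_on S g \<Longrightarrow> smooth_on S (\<lambda>x. f x * g x)"
  by (simp add: smooth_on_def Ck_on_mult)

lemma smooth_on_sum:
  "open S \<Longrightarrow> (\<And>i. i \<in> I \<Longrightarrow> smooth_on S (f i)) \<Longrightarrow> smooth_on S (\<lambda>x. \<Sum>i\<in>I. f i x)"
  by (simp add: smooth_on_def Ck_on_sum)

lemma smooth_on_compose:
  fixes f :: "'b::euclidean_space \<Rightarrow> real"
  shows "open S \<Longrightarrow> c ` S \<subseteq> T \<Longrightarrow> smooth_on T f \<Longrightarrow> smooth_on S c \<Longrightarrow> smooth_on S (\<lambda>x. f (c x))"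
  unfolding smooth_on_def using Ck_on_compose by blast

lemma smooth_on_differentiable: "smooth_on S f \<Longrightarrow> x \<in> S \<Longrightarrow> f differentiable (at x)"
  unfolding smooth_on_def by (metis Ck_on.simps(2))

lemma smooth_on_frechet_derivative:
  "smooth_on S f \<Longrightarrow> smooth_on S (\<lambda>x. frechet_derivative f (at x) v)"
  unfolding smooth_on_def by (metis Ck_on.simps(2))

lemma smooth_on_continuous: "smooth_on S f \<Longrightarrow> continuous_on S f"
  unfolding smooth_on_def by (metis Ck_on.simps(1))

section \<open>Bump functions and Hadamard's lemma\<close>

text \<open>The functions \<open>x\<^sup>-\<^sup>n exp (-1/x)\<close>, extended by zero to the left half-line, form
  a family whose derivatives are linear combinations of members of the family, so
  that one induction shows all of them to be smooth.\<close>

definition flat_exp :: "nat \<Rightarrow> real \<Rightarrow> real"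
  where "flat_exp n x = (if x \<le> 0 then 0 else inverse x ^ n * exp (- inverse x))"

lemma flat_exp_tendsto_0: "((\<lambda>y. flat_exp n y) \<longlongrightarrow> 0) (at 0)"
proof -
  have "((\<lambda>x::real. x ^ n / exp x) \<longlongrightarrow> 0) at_top" by (rule tendsto_power_div_exp_0)
  then have "((\<lambda>x::real. inverse x ^ n / exp (inverse x)) \<longlongrightarrow> 0) (at_right 0)"
    by (rule filterlim_compose[OF _ filterlim_inverse_at_top_right])
  then have r: "((\<lambda>y. flat_exp n y) \<longlongrightarrow> 0) (at_right 0)"
    by (rule Lim_transform_eventually)
      (auto simp: eventually_at_filter flat_exp_def exp_minus field_simps intro!: always_eventually)
  have l: "((\<lambda>y. flat_exp n y) \<longlongrightarrow> 0) (at_left 0)"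
    by (rule Lim_transform_eventually[OF tendsto_const])
      (auto simp: eventually_at_filter flat_exp_def)
  show ?thesis using l r by (simp add: filterlim_at_split)
qed

lemma flat_exp_has_derivative:
  "(flat_exp n has_derivative (\<lambda>v. v * (flat_exp (n + 2) x - of_nat n * flat_exp (n + 1) x))) (at x)"
proof -
  let ?d = "flat_exp (n + 2) x - of_nat n * flat_exp (n + 1) x"
  have "(flat_exp n has_real_derivative ?d) (at x)"
  proof (cases x "0::real" rule: linorder_cases)
    case less
    have "((\<lambda>x. 0) has_real_derivative 0) (at x)" by simp
    then have "(flat_exp n has_real_derivative 0) (at x)"
      by (rule has_field_derivative_transform_within_open[where S = "{..<0}"])
        (use less in \<open>auto simp: flat_exp_def\<close>)
    then show ?thesis using less by (simp add: flat_exp_def)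
  next
    case equal
    have "((\<lambda>h. (flat_exp n (0 + h) - flat_exp n 0) / h) \<longlongrightarrow> 0) (at 0)"
      by (rule Lim_transform_eventually[OF flat_exp_tendsto_0[of "Suc n"]])
        (auto simp: flat_exp_def eventually_at_filter field_simps)
    then show ?thesis using equal by (simp add: DERIV_def flat_exp_def)
  next
    case greater
    have "((\<lambda>x. inverse x ^ n * exp (- inverse x)) has_real_derivative
        (of_nat n * inverse x ^ (n - 1)) * (- (inverse x ^ 2)) * exp (- inverse x)
        + inverse x ^ n * (exp (- inverse x) * inverse x ^ 2)) (at x)"
      using greater by (auto intro!: derivative_eq_intros simp: power2_eq_square)
    moreover have "(of_nat n * inverse x ^ (n - 1)) * (- (inverse x ^ 2)) * exp (- inverse x)
        + inverse x ^ n * (exp (- inverse x) * inverse x ^ 2) = ?d"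
      using greater by (cases n) (auto simp: flat_exp_def power2_eq_square)
    ultimately have "((\<lambda>x. inverse x ^ n * exp (- inverse x)) has_real_derivative ?d) (at x)" by simp
    then show ?thesis
      by (rule has_field_derivative_transform_within_open[where S = "{0<..}"])
        (use greater in \<open>auto simp: flat_exp_def\<close>)
  qed
  then show ?thesis
    unfolding has_field_derivative_def by (rule has_derivative_eq_rhs) (auto simp: mult.commute)
qed

lemma smooth_on_flat_exp: "smooth_on UNIV (flat_exp n)"
proof -
  have "Ck_on k UNIV (flat_exp n)" for k
  proof (induction k arbitrary: n)
    case 0
    show ?case
      by (auto intro!: continuous_at_imp_continuous_on has_derivative_continuous flat_exp_has_derivative)
  next
    case (Suc k)
    have "Ck_on k UNIV (\<lambda>x. v * (flat_exp (n + 2) x + (- of_nat n) * flat_exp (n + 1) x))" for v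
      by (intro Ck_on_mult Ck_on_add Suc Ck_on_const) auto
    then show ?case
      by (intro Ck_on_SucI[OF _ flat_exp_has_derivative]) simp_all
  qed
  then show ?thesis by (simp add: smooth_on_def)
qed

text \<open>The function \<open>exp (-1/t)\<close> composed with \<open>t = r\<^sup>2 - |x - a|\<^sup>2\<close>, normalised at the
  centre.\<close>

lemma bump_exists:
  fixes a :: "'a::euclidean_space"
  assumes "r > 0"
  obtains \<beta> :: "'a \<Rightarrow> real"
  where "smooth_on UNIV \<beta>" "\<beta> a = 1" "\<And>x. x \<notin> cball a r \<Longrightarrow> \<beta> x = 0"
proof
  define s where "s = flat_exp 0 (r\<^sup>2)"
  define q :: "'a \<Rightarrow> real" where "q x = r\<^sup>2 + (-1) * (\<Sum>b\<in>Basis. (x \<bullet> b + (- (a \<bullet> b))) * (x \<bullet> b + (- (a \<bullet> b))))" for x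
  have q: "q x = r\<^sup>2 - (dist a x)\<^sup>2" for x
    unfolding q_def dist_norm power2_norm_eq_inner
    by (subst euclidean_inner) (auto simp: inner_diff_left algebra_simps)
  have "smooth_on UNIV q"
    unfolding q_def by (intro smooth_on_add smooth_on_mult smooth_on_sum smooth_on_const smooth_on_inner) auto
  then show "smooth_on UNIV (\<lambda>x. inverse s * flat_exp 0 (q x))"
    using smooth_on_compose[of UNIV q UNIV "flat_exp 0"] smooth_on_flat_exp
    by (intro smooth_on_mult smooth_on_const) auto
  show "inverse s * flat_exp 0 (q a) = 1"
    using assms by (simp add: q s_def flat_exp_def)
  show "inverse s * flat_exp 0 (q x) = 0" if "x \<notin> cball a r" for x
    using that assms by (auto simp: q flat_exp_def power_mono)
qed

text \<open>Differentiation under the integral sign maps the mean with weight \<open>t\<^sup>m\<close> of a function to the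
  mean with weight \<open>t\<^sup>m\<^sup>+\<^sup>1\<close> of its derivative. The weight is part of the statement to let
  the induction over the order of differentiability close.\<close>

lemma radial_mean_smooth:
  fixes F :: "'a::euclidean_space \<Rightarrow> real"
  assumes "open B" "convex B" "a \<in> B" "smooth_on B F"
  shows "smooth_on B (\<lambda>x. integral {0..1} (\<lambda>t. t ^ m * F (a + t *\<^sub>R (x - a))))"
proof -
  have inB: "a + t *\<^sub>R (x - a) \<in> B" if "x \<in> B" "t \<in> {0..1}" for x t
  proof -
    have "(1 - t) *\<^sub>R a + t *\<^sub>R x \<in> B"
      using assms(2,3) that by (intro convexD) auto
    then show ?thesis by (simp add: algebra_simps)
  qed
  have contF: "continuous_on (B \<times> {0..1}) (\<lambda>(x, t). t ^ m * G (a + t *\<^sub>R (x - a)))"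
    if "smooth_on B G" for G :: "'a \<Rightarrow> real" and m
    unfolding split_beta
    by (intro continuous_intros continuous_on_compose2[OF smooth_on_continuous[OF that]])
      (auto intro: inB)
  have cont1: "continuous_on {0..1} (\<lambda>t. t ^ m * G (a + t *\<^sub>R (x - a)))"
    if "smooth_on B G" "x \<in> B" for G :: "'a \<Rightarrow> real" and m x
    by (intro continuous_intros continuous_on_compose2[OF smooth_on_continuous[OF that(1)]])
      (use that in \<open>auto intro: inB\<close>)
  let ?I = "\<lambda>m G x. integral {0..1} (\<lambda>t. t ^ m * G (a + t *\<^sub>R (x - a)))"
  have der: "(?I m G has_derivative
      (\<lambda>v. ?I (Suc m) (\<lambda>y. frechet_derivative G (at y) v) x)) (at x)"
    if G: "smooth_on B G" and x: "x \<in> B" for G :: "'a \<Rightarrow> real" and m x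
  proof -
    define L where "L x t = t ^ Suc m *\<^sub>R Blinfun (frechet_derivative G (at (a + t *\<^sub>R (x - a))))" for x t
    have Lapp: "blinfun_apply (L x t) v = t ^ Suc m * frechet_derivative G (at (a + t *\<^sub>R (x - a))) v"
      if "x \<in> B" "t \<in> {0..1}" for x t v
    proof -
      have "bounded_linear (frechet_derivative G (at (a + t *\<^sub>R (x - a))))"
        using smooth_on_differentiable[OF G inB[OF that]]
        by (simp add: frechet_derivative_works has_derivative_bounded_linear)
      then show ?thesis by (simp add: L_def scaleR_blinfun.rep_eq bounded_linear_Blinfun_apply)
    qed
    have "(?I m G has_derivative integral (cbox 0 1) (L x)) (at x within B)"
      unfolding cbox_interval[symmetric]
    proof (rule leibniz_rule[OF _ _ _ x assms(2)])
      show "((\<lambda>x. t ^ m * G (a + t *\<^sub>R (x - a))) has_derivative blinfun_apply (L x t)) (at x within B)"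
        if "x \<in> B" "t \<in> cbox 0 1" for x t
      proof -
        have t: "t \<in> {0..1}" using that by simp
        have "(G has_derivative frechet_derivative G (at (a + t *\<^sub>R (x - a)))) (at (a + t *\<^sub>R (x - a)))"
          using smooth_on_differentiable[OF G inB[OF that(1) t]] by (simp add: frechet_derivative_works)
        then have "((\<lambda>x. G (a + t *\<^sub>R (x - a))) has_derivative
            (\<lambda>v. frechet_derivative G (at (a + t *\<^sub>R (x - a))) (t *\<^sub>R v))) (at x within B)"
          by (rule has_derivative_compose[of "\<lambda>x. a + t *\<^sub>R (x - a)" "\<lambda>v. t *\<^sub>R v", rotated])
            (auto intro!: derivative_eq_intros)
        then have "((\<lambda>x. t ^ m * G (a + t *\<^sub>R (x - a))) has_derivative
            (\<lambda>v. t ^ m * frechet_derivative G (at (a + t *\<^sub>R (x - a))) (t *\<^sub>R v))) (at x within B)"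
          by (rule has_derivative_mult_right)
        moreover have "(\<lambda>v. t ^ m * frechet_derivative G (at (a + t *\<^sub>R (x - a))) (t *\<^sub>R v)) = blinfun_apply (L x t)"
          using smooth_on_differentiable[OF G inB[OF that(1) t]]
          by (auto simp: Lapp[OF that(1) t] linear_cmul[OF linear_frechet_derivative])
        ultimately show ?thesis by simp
      qed
      show "(\<lambda>t. t ^ m * G (a + t *\<^sub>R (x - a))) integrable_on cbox 0 1" if "x \<in> B" for x
        using cont1[OF G that] by (simp add: integrable_continuous_real)
      show "continuous_on (B \<times> cbox 0 1) (\<lambda>(x, t). L x t)"
      proof (rule continuous_on_blinfun_componentwise)
        fix i :: 'a assume "i \<in> Basis"
        have "continuous_on (B \<times> {0..1}) (\<lambda>(x, t). t ^ Suc m * frechet_derivative G (at (a + t *\<^sub>R (x - a))) i)"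
          by (rule contF[OF smooth_on_frechet_derivative[OF G]])
        then show "continuous_on (B \<times> cbox 0 1) (\<lambda>p. blinfun_apply (case p of (x, t) \<Rightarrow> L x t) i)"
          unfolding cbox_interval by (rule continuous_on_eq) (auto simp: Lapp)
      qed
    qed
    then have "(?I m G has_derivative integral (cbox 0 1) (L x)) (at x)"
      by (simp only: at_within_open[OF x assms(1)])
    moreover have "blinfun_apply (integral (cbox 0 1) (L x)) v
        = ?I (Suc m) (\<lambda>y. frechet_derivative G (at y) v) x" for v
    proof -
      have "continuous_on {0..1} (L x)"
      proof (rule continuous_on_blinfun_componentwise)
        fix i :: 'a assume "i \<in> Basis"
        show "continuous_on {0..1} (\<lambda>t. blinfun_apply (L x t) i)"
          by (rule continuous_on_eq[OF cont1[OF smooth_on_frechet_derivative[OF G, of i] x, of "Suc m"]])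
            (simp only: Lapp[OF x])
      qed
      then have "L x integrable_on {0..1}" by (simp add: integrable_continuous_real)
      then have "blinfun_apply (integral {0..1} (L x)) v = integral {0..1} (\<lambda>t. blinfun_apply (L x t) v)"
        using integral_linear[of "L x" "{0..1}" "\<lambda>f. blinfun_apply f v"]
        by (simp add: o_def blinfun.bounded_linear_left)
      also have "\<dots> = ?I (Suc m) (\<lambda>y. frechet_derivative G (at y) v) x"
        by (rule integral_cong) (simp add: Lapp x)
      finally show ?thesis by simp
    qed
    ultimately show ?thesis by (metis (no_types, lifting) ext)
  qed
  have "Ck_on k B (?I m G)" if "smooth_on B G" for k m and G :: "'a \<Rightarrow> real"
    using that
  proof (induction k arbitrary: m G)
    case 0
    show ?case
      by (auto intro!: continuous_at_imp_continuous_on has_derivative_continuous[OF der] 0)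
  next
    case (Suc k)
    show ?case
      by (rule Ck_on_SucI[OF assms(1) der[OF Suc.prems]])
        (assumption | rule Suc.IH[OF smooth_on_frechet_derivative[OF Suc.prems]])+
  qed
  then show ?thesis using assms(4) by (simp add: smooth_on_def)
qed

text \<open>The fundamental theorem of calculus along the segment from \<open>a\<close> to \<open>x\<close> exhibits \<open>F x - F a\<close> as
  a combination of the functions \<open>(x - a) \<bullet> b\<close>, which vanish at \<open>a\<close>, with smooth coefficients. For a
  derivation at \<open>a\<close>, only the values of the coefficients at \<open>a\<close> will count.\<close>

lemma hadamard:
  fixes F :: "'a::euclidean_space \<Rightarrow> real"
  assumes "open B" "convex B" "a \<in> B" "smooth_on B F"
  obtains G :: "'a \<Rightarrow> 'a \<Rightarrow> real"
  where "\<And>b. smooth_on B (G b)" "\<And>b. G b a = frechet_derivative F (at a) b"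
    "\<And>x. x \<in> B \<Longrightarrow> F x = F a + (\<Sum>b\<in>Basis. ((x - a) \<bullet> b) * G b x)"
proof
  let ?G = "\<lambda>b x. integral {0..1} (\<lambda>t. t ^ 0 * frechet_derivative F (at (a + t *\<^sub>R (x - a))) b)"
  show "smooth_on B (?G b)" for b
    by (rule radial_mean_smooth[OF assms(1-3) smooth_on_frechet_derivative[OF assms(4)]])
  show "?G b a = frechet_derivative F (at a) b" for b by simp
  show "F x = F a + (\<Sum>b\<in>Basis. ((x - a) \<bullet> b) * ?G b x)" if x: "x \<in> B" for x
  proof -
    have inB: "a + t *\<^sub>R (x - a) \<in> B" if "t \<in> {0..1}" for t
    proof -
      have "(1 - t) *\<^sub>R a + t *\<^sub>R x \<in> B"
        using assms(2,3) x that by (intro convexD) auto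
      then show ?thesis by (simp add: algebra_simps)
    qed
    have int: "(\<lambda>t. frechet_derivative F (at (a + t *\<^sub>R (x - a))) b) integrable_on {0..1}" for b
      by (rule integrable_continuous_real)
        (auto intro!: continuous_intros inB
          continuous_on_compose2[OF smooth_on_continuous[OF smooth_on_frechet_derivative[OF assms(4)]]])
    have d: "F differentiable (at (a + t *\<^sub>R (x - a)))" if "t \<in> {0..1}" for t
      using smooth_on_differentiable[OF assms(4) inB[OF that]] .
    have "((\<lambda>t. frechet_derivative F (at (a + t *\<^sub>R (x - a))) (x - a)) has_integral
        F (a + 1 *\<^sub>R (x - a)) - F (a + 0 *\<^sub>R (x - a))) {0..1}"
    proof (rule fundamental_theorem_of_calculus)
      fix t :: real assume t: "t \<in> {0..1}"
      have "(F has_derivative frechet_derivative F (at (a + t *\<^sub>R (x - a)))) (at (a + t *\<^sub>R (x - a)))"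
        using d[OF t] by (simp add: frechet_derivative_works)
      then have "((\<lambda>t. F (a + t *\<^sub>R (x - a))) has_derivative
          (\<lambda>s. frechet_derivative F (at (a + t *\<^sub>R (x - a))) (s *\<^sub>R (x - a)))) (at t within {0..1})"
        by (rule has_derivative_compose[of "\<lambda>t. a + t *\<^sub>R (x - a)" "\<lambda>s. s *\<^sub>R (x - a)", rotated])
          (auto intro!: derivative_eq_intros)
      then show "((\<lambda>t. F (a + t *\<^sub>R (x - a))) has_vector_derivative
          frechet_derivative F (at (a + t *\<^sub>R (x - a))) (x - a)) (at t within {0..1})"
        by (simp add: has_vector_derivative_def linear_cmul[OF linear_frechet_derivative[OF d[OF t]]])
    qed simp
    then have "F x - F a = integral {0..1} (\<lambda>t. frechet_derivative F (at (a + t *\<^sub>R (x - a))) (x - a))"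
      by (simp add: integral_unique)
    also have "\<dots> = integral {0..1} (\<lambda>t. \<Sum>b\<in>Basis. ((x - a) \<bullet> b) * frechet_derivative F (at (a + t *\<^sub>R (x - a))) b)"
      by (rule integral_cong) (rule frechet_derivative_components[OF d])
    also have "\<dots> = (\<Sum>b\<in>Basis. ((x - a) \<bullet> b) * ?G b x)"
      using int by (subst integral_sum) (auto intro: integrable_on_mult_right)
    finally show ?thesis by simp
  qed
qed

section \<open>Smooth functions and derivations on a manifold\<close>

lemma sum_fun_apply: "(\<Sum>i\<in>I. f i) x = (\<Sum>i\<in>I. f i x)"
  by (induction I rule: infinite_finite_induct) auto

lemma scaleR_fun_apply: "(c *\<^sub>R f) x = c *\<^sub>R f x"
  by (simp add: scaleR_fun_def)

lemma fscale_apply: "(f \<odot> X) p = f p *\<^sub>R X p"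
  by (simp add: fscale_def)

locale smooth_manifold =
  fixes A :: "('m::{t2_space,second_countable_topology}, 'e::euclidean_space) chart set"
  assumes atlas: "smooth_atlas A"
begin

lemma chartD:
  assumes "(U, c) \<in> A"
  shows "open U" "open (c ` U)" "continuous_on U c" "continuous_on (c ` U) (inv_into U c)"
    "inj_on c U"
proof -
  have *: "open U \<and> open (c ` U) \<and> homeomorphism U (c ` U) c (inv_into U c)"
    using atlas assms unfolding smooth_atlas_def by blast
  then show "open U" "open (c ` U)" "continuous_on U c" "continuous_on (c ` U) (inv_into U c)"
    by (auto simp: homeomorphism_def)
  show "inj_on c U"
    using * by (metis homeomorphism_def inj_on_inverseI)
qed

lemma chart_image_open:
  assumes "(U, c) \<in> A" "open W" "W \<subseteq> U"
  shows "open (c ` W)"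
proof -
  have "open (c ` U \<inter> inv_into U c -` W)"
    using chartD[OF assms(1)] assms(2) by (intro continuous_open_preimage) auto
  moreover have "c ` U \<inter> inv_into U c -` W = c ` W"
    using chartD(5)[OF assms(1)] assms(3) by auto
  ultimately show ?thesis by simp
qed

lemma chart_cover: obtains U c where "(U, c) \<in> A" "p \<in> U"
proof -
  have "p \<in> (\<Union>(U, c)\<in>A. U)" using atlas unfolding smooth_atlas_def by simp
  then show thesis using that by auto
qed

lemma transition_smooth:
  "(U, c) \<in> A \<Longrightarrow> (V, d) \<in> A \<Longrightarrow> smooth_on (c ` (U \<inter> V)) (d \<circ> inv_into U c)"
  using atlas unfolding smooth_atlas_def by fast

lemma smooth_funD: "smooth_fun A f \<Longrightarrow> (U, c) \<in> A \<Longrightarrow> smooth_on (c ` U) (f \<circ> inv_into U c)"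
  unfolding smooth_fun_def by fast

lemma smooth_funI:
  "(\<And>U c. (U, c) \<in> A \<Longrightarrow> smooth_on (c ` U) (\<lambda>x. f (inv_into U c x))) \<Longrightarrow> smooth_fun A f"
  unfolding smooth_fun_def o_def by fast

lemma smooth_fun_const: "smooth_fun A (\<lambda>x. a)"
  by (intro smooth_funI smooth_on_const chartD)

lemma smooth_fun_add: "smooth_fun A f \<Longrightarrow> smooth_fun A g \<Longrightarrow> smooth_fun A (\<lambda>x. f x + g x)"
  by (intro smooth_funI smooth_on_add chartD) (auto dest: smooth_funD simp: o_def)

lemma smooth_fun_mult: "smooth_fun A f \<Longrightarrow> smooth_fun A g \<Longrightarrow> smooth_fun A (\<lambda>x. f x * g x)"
  by (intro smooth_funI smooth_on_mult chartD) (auto dest: smooth_funD simp: o_def)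

lemma smooth_fun_diff: "smooth_fun A f \<Longrightarrow> smooth_fun A g \<Longrightarrow> smooth_fun A (\<lambda>x. f x - g x)"
  using smooth_fun_add[OF _ smooth_fun_mult[OF smooth_fun_const[of "-1"]], of f g] by simp

lemma smooth_fun_sum:
  "(\<And>i. i \<in> I \<Longrightarrow> smooth_fun A (f i)) \<Longrightarrow> smooth_fun A (\<lambda>x. \<Sum>i\<in>I. f i x)"
  by (induction I rule: infinite_finite_induct) (auto intro: smooth_fun_const smooth_fun_add)

lemmas smooth_fun_intros =
  smooth_fun_const smooth_fun_add smooth_fun_mult smooth_fun_diff smooth_fun_sum

text \<open>A function given in one chart extends by zero to the whole manifold as soon as it vanishes off a
  compact ball; the Hausdorff property makes the preimage of that ball closed.\<close>

definition zero_ext :: "'m set \<Rightarrow> ('m \<Rightarrow> 'e) \<Rightarrow> 'e set \<Rightarrow> ('e \<Rightarrow> real) \<Rightarrow> 'm \<Rightarrow> real"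
  where "zero_ext U c B G q = (if q \<in> U \<and> c q \<in> B then G (c q) else 0)"

lemma smooth_fun_zero_ext:
  assumes U: "(U, c) \<in> A" and B: "open B" "B \<subseteq> c ` U" "cball a r \<subseteq> B"
    and G: "smooth_on B G" "\<And>x. x \<in> B \<Longrightarrow> x \<notin> cball a r \<Longrightarrow> G x = 0"
  shows "smooth_fun A (zero_ext U c B G)"
proof (rule smooth_funI)
  fix V d assume V: "(V, d) \<in> A"
  define K where "K = inv_into U c ` cball a r"
  have "compact K"
    unfolding K_def using chartD(4)[OF U] B
    by (intro compact_continuous_image) (auto intro: continuous_on_subset)
  then have K: "closed K" by (rule compact_imp_closed)
  show "smooth_on (d ` V) (\<lambda>x. zero_ext U c B G (inv_into V d x))"
  proof (rule smooth_on_locally)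
    fix y assume "y \<in> d ` V"
    then obtain q where q: "q \<in> V" "y = d q" by auto
    have inv: "inv_into V d (d q') = q'" if "q' \<in> V" for q'
      using chartD(5)[OF V] that by simp
    show "\<exists>T. open T \<and> y \<in> T \<and> smooth_on T (\<lambda>x. zero_ext U c B G (inv_into V d x))"
    proof (cases "q \<in> U \<and> c q \<in> B")
      case True
      define W where "W = V \<inter> (U \<inter> c -` B)"
      have "open W"
        unfolding W_def using chartD[OF U] chartD(1)[OF V] B
        by (intro open_Int continuous_open_preimage) auto
      then have T: "open (d ` W)" by (rule chart_image_open[OF V]) (simp add: W_def)
      have "smooth_on (d ` W) (c \<circ> inv_into V d)"
        by (rule smooth_on_subset[OF transition_smooth[OF V U]]) (auto simp: W_def)
      then have "smooth_on (d ` W) (\<lambda>x. G ((c \<circ> inv_into V d) x))"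
        by (rule smooth_on_compose[OF T _ G(1), rotated]) (auto simp: W_def inv)
      then have "smooth_on (d ` W) (\<lambda>x. zero_ext U c B G (inv_into V d x))"
        by (rule smooth_on_cong[OF T, rotated]) (auto simp: W_def inv zero_ext_def)
      then show ?thesis using T True q by (auto simp: W_def)
    next
      case False
      have "q \<notin> K"
      proof
        assume "q \<in> K"
        then obtain x where "x \<in> cball a r" "q = inv_into U c x" by (auto simp: K_def)
        moreover from this have "x \<in> B" "x \<in> c ` U" using B by auto
        ultimately have "q \<in> U" "c q \<in> B" by (auto simp: inv_into_into f_inv_into_f)
        then show False using False by simp
      qed
      have T: "open (d ` (V - K))"
        using chartD(1)[OF V] K by (intro chart_image_open[OF V]) auto
      have "zero_ext U c B G q' = 0" if "q' \<notin> K" for q'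
      proof -
        have "c q' \<notin> cball a r" if "q' \<in> U"
          using \<open>q' \<notin> K\<close> chartD(5)[OF U] that unfolding K_def by (metis image_eqI inv_into_f_f)
        then show ?thesis using G(2) by (auto simp: zero_ext_def)
      qed
      then have "smooth_on (d ` (V - K)) (\<lambda>x. zero_ext U c B G (inv_into V d x))"
        by (intro smooth_on_cong[OF T _ smooth_on_const[OF T, of 0]]) (auto simp: inv)
      then show ?thesis using T q \<open>q \<notin> K\<close> by blast
    qed
  qed
qed

lemma tangent_nonsmooth: "v \<in> tangent_space A p \<Longrightarrow> \<not> smooth_fun A f \<Longrightarrow> v f = 0"
  unfolding tangent_space_def by blast

lemma tangent_lin:
  "v \<in> tangent_space A p \<Longrightarrow> smooth_fun A f \<Longrightarrow> smooth_fun A g \<Longrightarrow>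
    v (\<lambda>x. a * f x + b * g x) = a * v f + b * v g"
  unfolding tangent_space_def by blast

lemma tangent_mult:
  "v \<in> tangent_space A p \<Longrightarrow> smooth_fun A f \<Longrightarrow> smooth_fun A g \<Longrightarrow>
    v (\<lambda>x. f x * g x) = f p * v g + g p * v f"
  unfolding tangent_space_def by blast

lemma tangent_const:
  assumes "v \<in> tangent_space A p"
  shows "v (\<lambda>x. a) = 0"
proof -
  have "v (\<lambda>x. 1 * 1) = 1 * v (\<lambda>x. 1) + 1 * v (\<lambda>x. 1)"
    by (rule tangent_mult[OF assms]) (rule smooth_fun_const)+
  then have "v (\<lambda>x. 1) = 0" by simp
  then show ?thesis
    using tangent_lin[OF assms smooth_fun_const[of 1] smooth_fun_const[of 1], of a 0] by simp
qed

lemma tangent_add: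
  "v \<in> tangent_space A p \<Longrightarrow> smooth_fun A f \<Longrightarrow> smooth_fun A g \<Longrightarrow>
    v (\<lambda>x. f x + g x) = v f + v g"
  using tangent_lin[of v p f g 1 1] by simp

lemma tangent_diff:
  "v \<in> tangent_space A p \<Longrightarrow> smooth_fun A f \<Longrightarrow> smooth_fun A g \<Longrightarrow>
    v (\<lambda>x. f x - g x) = v f - v g"
  using tangent_lin[of v p f g 1 "-1"] by simp

lemma tangent_cmult:
  "v \<in> tangent_space A p \<Longrightarrow> smooth_fun A f \<Longrightarrow> v (\<lambda>x. a * f x) = a * v f"
  using tangent_lin[of v p f f a 0] by simp

lemma tangent_sum:
  assumes "v \<in> tangent_space A p"
  shows "(\<And>i. i \<in> I \<Longrightarrow> smooth_fun A (f i)) \<Longrightarrow> v (\<lambda>x. \<Sum>i\<in>I. f i x) = (\<Sum>i\<in>I. v (f i))"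
proof (induction I rule: infinite_finite_induct)
  case (insert i I)
  then have "v (\<lambda>x. f i x + (\<Sum>i\<in>I. f i x)) = v (f i) + v (\<lambda>x. \<Sum>i\<in>I. f i x)"
    by (intro tangent_add[OF assms] smooth_fun_sum) auto
  then show ?case using insert by simp
qed (simp_all add: tangent_const[OF assms])

lemma subspace_tangent_space: "subspace (tangent_space A p)"
  unfolding subspace_def tangent_space_def
  by (auto simp: scaleR_fun_apply algebra_simps)

lemma vector_fieldsD: "X \<in> vector_fields A \<Longrightarrow> X p \<in> tangent_space A p"
  "X \<in> vector_fields A \<Longrightarrow> smooth_fun A f \<Longrightarrow> smooth_fun A (deriv_along X f)"
  unfolding vector_fields_def by auto

section \<open>Local frames and tensoriality\<close>

text \<open>Everything about tangent vectors that needs analysis is contained in this lemma. Let \<open>\<rho>\<close> be a bump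
  function supported in a coordinate ball around \<open>p\<close>, with coordinates \<open>x\<^sub>b\<close>. The functions \<open>\<rho> x\<^sub>b\<close>
  and the fields \<open>E b = \<rho> \<partial>\<^sub>b\<close> are defined globally. Hadamard's lemma at a point \<open>q\<close>,
  multiplied by \<open>\<rho>\<^sup>2\<close>, is an identity between global smooth functions, and applying a derivation \<open>v\<close>
  at \<open>q\<close> to it gives
  \<open>\<rho>\<^sup>2 v f = (\<Sum>b\<in>Basis. (v (\<rho> x\<^sub>b) - x\<^sub>b v \<rho>) * E b f)\<close>. At \<open>q = p\<close>, where \<open>\<rho> = 1\<close>, this says
  that the \<open>E b\<close> span the tangent space, and the functionals \<open>v (\<rho> x\<^sub>b) - x\<^sub>b v \<rho>\<close> form the dual
  basis. One more factor \<open>\<rho>\<close> turns the coefficients of a vector field into global smooth functions;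
  hence \<open>k = 1 - \<rho>\<^sup>3\<close>.\<close>

lemma local_frame:
  fixes p :: 'm
  obtains E :: "'e \<Rightarrow> 'm vfield" and k :: "'m \<Rightarrow> real"
  where "\<And>b. E b \<in> vector_fields A" "smooth_fun A k" "k p = 0"
    "\<And>Z. Z \<in> vector_fields A \<Longrightarrow>
      \<exists>f. (\<forall>b. smooth_fun A (f b)) \<and> Z = (\<Sum>b\<in>Basis. f b \<odot> E b) + k \<odot> Z"
    "\<And>v. v \<in> tangent_space A p \<Longrightarrow> \<exists>a. v = (\<Sum>b\<in>Basis. a b *\<^sub>R E b p)"
    "\<And>a j. (\<Sum>b\<in>Basis. a b *\<^sub>R E b p) = 0 \<Longrightarrow> j \<in> Basis \<Longrightarrow> a j = 0"
proof -
  obtain U c where U: "(U, c) \<in> A" "p \<in> U" by (rule chart_cover)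
  obtain s where s: "s > 0" "ball (c p) s \<subseteq> c ` U"
    using chartD(2)[OF U(1)] U(2) by (meson image_eqI openE)
  \<comment> \<open>The bump function is supported in a closed ball inside the convex open set \<open>B\<close>, which is
    star-shaped about each of its points, so that Hadamard's lemma applies at each of them.\<close>
  define r where "r = s / 2"
  define B where "B = ball (c p) s"
  have r: "r > 0" "cball (c p) r \<subseteq> B" using s by (auto simp: r_def B_def)
  have B: "open B" "convex B" "B \<subseteq> c ` U" "c p \<in> B" using s by (auto simp: B_def)
  obtain \<beta> :: "'e \<Rightarrow> real" where \<beta>: "smooth_on UNIV \<beta>" "\<beta> (c p) = 1"
      "\<And>x. x \<notin> cball (c p) r \<Longrightarrow> \<beta> x = 0"
    using bump_exists[OF r(1)] by blast
  have \<beta>B: "smooth_on B \<beta>" using \<beta>(1) smooth_on_subset by blast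
  define cut where "cut G = zero_ext U c B (\<lambda>x. \<beta> x * G x)" for G
  have cut: "smooth_fun A (cut G)" if "smooth_on B G" for G
    unfolding cut_def using \<beta>(3)
    by (intro smooth_fun_zero_ext[OF U(1) B(1) B(3) r(2)] smooth_on_mult B(1) \<beta>B that) auto
  have cut_apply: "cut G q = (if q \<in> U \<and> c q \<in> B then \<beta> (c q) * G (c q) else 0)" for G q
    by (simp add: cut_def zero_ext_def)
  have inv: "inv_into U c (c q) = q" if "q \<in> U" for q
    using chartD(5)[OF U(1)] that by simp
  have loc: "smooth_on B (f \<circ> inv_into U c)" if "smooth_fun A f" for f
    using smooth_on_subset[OF smooth_funD[OF that U(1)] B(3)] .
  have diff: "(f \<circ> inv_into U c) differentiable (at (c q))"
    if "smooth_fun A f" "c q \<in> B" for f q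
    using smooth_on_differentiable[OF loc] that by blast
  define E where "E b q f = (if smooth_fun A f
      then cut (\<lambda>x. frechet_derivative (f \<circ> inv_into U c) (at x) b) q else 0)" for b q f
  define \<rho> where "\<rho> = cut (\<lambda>x. 1)"
  define y where "y b = cut (\<lambda>x. x \<bullet> b)" for b
  have sm: "smooth_fun A \<rho>" "smooth_fun A (y b)" for b
    unfolding \<rho>_def y_def using B(1) by (auto intro!: cut smooth_on_const smooth_on_inner)
  have \<rho>p: "\<rho> p = 1" using U B \<beta>(2) by (simp add: \<rho>_def cut_apply)
  have y\<rho>: "y b q = (c q \<bullet> b) * \<rho> q" for b q by (simp add: y_def \<rho>_def cut_apply)
  have E_tangent: "E b q \<in> tangent_space A q" for b q
    unfolding tangent_space_def
  proof (intro CollectI conjI allI impI)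
    fix f g :: "'m \<Rightarrow> real" and a1 a2 :: real
    assume f: "smooth_fun A f" and g: "smooth_fun A g"
    have lin: "frechet_derivative ((\<lambda>x. a1 * f x + a2 * g x) \<circ> inv_into U c) (at (c q)) b
        = a1 * frechet_derivative (f \<circ> inv_into U c) (at (c q)) b
        + a2 * frechet_derivative (g \<circ> inv_into U c) (at (c q)) b" if "c q \<in> B"
    proof -
      have "(((\<lambda>x. a1 * f x + a2 * g x) \<circ> inv_into U c) has_derivative
         (\<lambda>v. a1 * frechet_derivative (f \<circ> inv_into U c) (at (c q)) v
            + a2 * frechet_derivative (g \<circ> inv_into U c) (at (c q)) v)) (at (c q))"
        using has_derivative_add[OF
            has_derivative_mult_right[OF diff[OF f that, unfolded frechet_derivative_works], of a1]
            has_derivative_mult_right[OF diff[OF g that, unfolded frechet_derivative_works], of a2]]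
        by (simp add: o_def)
      from fun_cong[OF frechet_derivative_at[OF this], of b] show ?thesis by simp
    qed
    show "E b q (\<lambda>x. a1 * f x + a2 * g x) = a1 * E b q f + a2 * E b q g"
      using lin f g by (simp add: E_def smooth_fun_intros cut_apply algebra_simps)
    have mul: "frechet_derivative ((\<lambda>x. f x * g x) \<circ> inv_into U c) (at (c q)) b
        = f q * frechet_derivative (g \<circ> inv_into U c) (at (c q)) b
        + g q * frechet_derivative (f \<circ> inv_into U c) (at (c q)) b" if "q \<in> U" "c q \<in> B"
    proof -
      have "(((\<lambda>x. f x * g x) \<circ> inv_into U c) has_derivative
         (\<lambda>v. (f \<circ> inv_into U c) (c q) * frechet_derivative (g \<circ> inv_into U c) (at (c q)) v
            + frechet_derivative (f \<circ> inv_into U c) (at (c q)) v * (g \<circ> inv_into U c) (c q))) (at (c q))"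
        using has_derivative_mult[OF diff[OF f that(2), unfolded frechet_derivative_works]
            diff[OF g that(2), unfolded frechet_derivative_works]]
        by (simp add: o_def)
      from fun_cong[OF frechet_derivative_at[OF this], of b] show ?thesis
        using that by (simp add: inv algebra_simps)
    qed
    show "E b q (\<lambda>x. f x * g x) = f q * E b q g + g q * E b q f"
      using mul f g by (simp add: E_def smooth_fun_intros cut_apply algebra_simps)
  qed (simp add: E_def)
  have E_field: "E b \<in> vector_fields A" for b
    unfolding vector_fields_def
  proof (intro CollectI conjI allI impI E_tangent)
    fix f assume f: "smooth_fun A f"
    have "deriv_along (E b) f = cut (\<lambda>x. frechet_derivative (f \<circ> inv_into U c) (at x) b)"
      using f by (simp add: deriv_along_def E_def fun_eq_iff)
    then show "smooth_fun A (deriv_along (E b) f)"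
      using cut[OF smooth_on_frechet_derivative[OF loc[OF f]]] by simp
  qed
  have key: "\<rho> q * \<rho> q * v f = (\<Sum>b\<in>Basis. (v (y b) - (c q \<bullet> b) * v \<rho>) * E b q f)"
    if v: "v \<in> tangent_space A q" and f: "smooth_fun A f" for v q f
  proof (cases "q \<in> U \<and> c q \<in> B")
    case False
    then have z: "cut G q = 0" for G by (auto simp: cut_apply)
    then have "E b q f = 0" for b by (simp add: E_def)
    then show ?thesis by (simp add: \<rho>_def z)
  next
    case True
    obtain G where G: "\<And>b. smooth_on B (G b)"
        "\<And>b. G b (c q) = frechet_derivative (f \<circ> inv_into U c) (at (c q)) b"
        "\<And>x. x \<in> B \<Longrightarrow> (f \<circ> inv_into U c) x = (f \<circ> inv_into U c) (c q) + (\<Sum>b\<in>Basis. ((x - c q) \<bullet> b) * G b x)"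
      using hadamard[OF B(1,2) _ loc[OF f], of "c q"] True by blast
    define u where "u b x = y b x - (c q \<bullet> b) * \<rho> x" for b x
    have u: "smooth_fun A (u b)" "u b q = 0" for b
      unfolding u_def by (intro smooth_fun_intros sm) (simp add: y\<rho>)
    have vu: "v (u b) = v (y b) - (c q \<bullet> b) * v \<rho>" for b
      unfolding u_def using tangent_diff[OF v sm(2), of "\<lambda>x. (c q \<bullet> b) * \<rho> x"] tangent_cmult[OF v sm(1)]
      by (simp add: smooth_fun_intros sm)
    have eq: "(\<lambda>x. (\<rho> x * \<rho> x) * (f x - f q)) = (\<lambda>x. \<Sum>b\<in>Basis. u b x * cut (G b) x)"
    proof
      fix x
      show "(\<rho> x * \<rho> x) * (f x - f q) = (\<Sum>b\<in>Basis. u b x * cut (G b) x)"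
      proof (cases "x \<in> U \<and> c x \<in> B")
        case False
        then show ?thesis by (auto simp: \<rho>_def cut_apply)
      next
        case x: True
        have "f x - f q = (\<Sum>b\<in>Basis. ((c x - c q) \<bullet> b) * G b (c x))"
          using G(3)[of "c x"] x True by (simp add: inv)
        moreover have "u b x * cut (G b) x = (\<rho> x * \<rho> x) * (((c x - c q) \<bullet> b) * G b (c x))" for b
          using x by (simp add: u_def y_def \<rho>_def cut_apply inner_diff_left algebra_simps)
        ultimately show ?thesis by (simp add: sum_distrib_left)
      qed
    qed
    \<comment> \<open>All products in \<open>eq\<close> have a factor vanishing at \<open>q\<close>; only the derivative of that factor
      survives in the product rule.\<close>
    have "v (\<lambda>x. (\<rho> x * \<rho> x) * (f x - f q)) = (\<rho> q * \<rho> q) * v (\<lambda>x. f x - f q)"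
      using tangent_mult[OF v, of "\<lambda>x. \<rho> x * \<rho> x" "\<lambda>x. f x - f q"] f sm
      by (simp add: smooth_fun_intros)
    also have "v (\<lambda>x. f x - f q) = v f"
      using tangent_diff[OF v f smooth_fun_const] tangent_const[OF v] by simp
    finally have "\<rho> q * \<rho> q * v f = v (\<lambda>x. \<Sum>b\<in>Basis. u b x * cut (G b) x)"
      by (simp add: eq)
    also have "\<dots> = (\<Sum>b\<in>Basis. v (\<lambda>x. u b x * cut (G b) x))"
      by (rule tangent_sum[OF v]) (intro smooth_fun_mult u cut G)
    also have "\<dots> = (\<Sum>b\<in>Basis. (v (y b) - (c q \<bullet> b) * v \<rho>) * E b q f)"
    proof (rule sum.cong)
      fix b
      have "v (\<lambda>x. u b x * cut (G b) x) = u b q * v (cut (G b)) + cut (G b) q * v (u b)"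
        by (rule tangent_mult[OF v u(1) cut[OF G(1)]])
      then show "v (\<lambda>x. u b x * cut (G b) x) = (v (y b) - (c q \<bullet> b) * v \<rho>) * E b q f"
        using f by (simp add: u(2) vu E_def cut_apply G(2))
    qed simp
    finally show ?thesis .
  qed
  have E_dual: "E b p (y j) - (c p \<bullet> j) * E b p \<rho> = b \<bullet> j" for b j
  proof -
    have d\<beta>: "(\<beta> has_derivative frechet_derivative \<beta> (at (c p))) (at (c p))"
      using smooth_on_differentiable[OF \<beta>(1)] by (simp add: frechet_derivative_works)
    have "((\<lambda>x. \<beta> x * (x \<bullet> j)) has_derivative
        (\<lambda>v. \<beta> (c p) * (v \<bullet> j) + frechet_derivative \<beta> (at (c p)) v * (c p \<bullet> j))) (at (c p))"
      by (intro has_derivative_mult d\<beta> bounded_linear_imp_has_derivative bounded_linear_inner_left)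
    then have "((y j \<circ> inv_into U c) has_derivative
        (\<lambda>v. \<beta> (c p) * (v \<bullet> j) + frechet_derivative \<beta> (at (c p)) v * (c p \<bullet> j))) (at (c p))"
      by (rule has_derivative_transform_within_open[OF _ B(1) B(4)])
        (use B in \<open>auto simp: y_def cut_apply inv_into_into f_inv_into_f subset_iff\<close>)
    from fun_cong[OF frechet_derivative_at[OF this], of b]
    have 1: "E b p (y j) = b \<bullet> j + frechet_derivative \<beta> (at (c p)) b * (c p \<bullet> j)"
      using U B sm \<beta>(2) by (simp add: E_def cut_apply)
    have "((\<rho> \<circ> inv_into U c) has_derivative frechet_derivative \<beta> (at (c p))) (at (c p))"
      by (rule has_derivative_transform_within_open[OF d\<beta> B(1) B(4)])
        (use B in \<open>auto simp: \<rho>_def cut_apply inv_into_into f_inv_into_f subset_iff\<close>)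
    from fun_cong[OF frechet_derivative_at[OF this], of b]
    have "E b p \<rho> = frechet_derivative \<beta> (at (c p)) b"
      using U B sm \<beta>(2) by (simp add: E_def cut_apply)
    then show ?thesis using 1 by simp
  qed
  define k where "k q = 1 - \<rho> q * \<rho> q * \<rho> q" for q
  show thesis
  proof (rule that[of E k])
    show "E b \<in> vector_fields A" for b by (rule E_field)
    show "smooth_fun A k" unfolding k_def by (intro smooth_fun_intros sm)
    show "k p = 0" by (simp add: k_def \<rho>p)
    show "\<exists>a. v = (\<Sum>b\<in>Basis. a b *\<^sub>R E b p)" if v: "v \<in> tangent_space A p" for v
    proof (intro exI ext)
      fix f
      show "v f = (\<Sum>b\<in>Basis. (v (y b) - (c p \<bullet> b) * v \<rho>) *\<^sub>R E b p) f"
        using key[OF v, of f] tangent_nonsmooth[OF v, of f]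
        by (cases "smooth_fun A f") (auto simp: \<rho>p sum_fun_apply scaleR_fun_apply E_def)
    qed
    show "a j = 0" if a: "(\<Sum>b\<in>Basis. a b *\<^sub>R E b p) = 0" and j: "j \<in> Basis" for a j
    proof -
      have z: "(\<Sum>b\<in>Basis. a b * E b p f) = 0" for f
        using fun_cong[OF a, of f] by (simp add: sum_fun_apply scaleR_fun_apply)
      have "a j = (\<Sum>b\<in>Basis. a b * (b \<bullet> j))"
        using j by (simp add: inner_Basis if_distrib sum.delta cong: if_cong)
      also have "\<dots> = (\<Sum>b\<in>Basis. a b * (E b p (y j) - (c p \<bullet> j) * E b p \<rho>))"
        by (simp only: E_dual)
      also have "\<dots> = (\<Sum>b\<in>Basis. a b * E b p (y j)) - (c p \<bullet> j) * (\<Sum>b\<in>Basis. a b * E b p \<rho>)"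
        by (simp add: algebra_simps sum_subtractf sum_distrib_left)
      finally show ?thesis by (simp add: z)
    qed
    show "\<exists>f. (\<forall>b. smooth_fun A (f b)) \<and> Z = (\<Sum>b\<in>Basis. f b \<odot> E b) + k \<odot> Z"
      if Z: "Z \<in> vector_fields A" for Z
    proof -
      define f where "f b q = \<rho> q * Z q (y b) - y b q * Z q \<rho>" for b q
      have "smooth_fun A (f b)" for b
        unfolding f_def using vector_fieldsD(2)[OF Z] sm
        by (intro smooth_fun_intros) (auto simp: deriv_along_def)
      moreover have "Z = (\<Sum>b\<in>Basis. f b \<odot> E b) + k \<odot> Z"
      proof (intro ext)
        fix q g
        have "\<rho> q * \<rho> q * \<rho> q * Z q g = (\<Sum>b\<in>Basis. f b q * E b q g)"
        proof (cases "smooth_fun A g")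
          case True
          have "\<rho> q * (\<rho> q * \<rho> q * Z q g) = (\<Sum>b\<in>Basis. \<rho> q * ((Z q (y b) - (c q \<bullet> b) * Z q \<rho>) * E b q g))"
            by (simp add: key[OF vector_fieldsD(1)[OF Z] True] sum_distrib_left)
          then show ?thesis by (simp add: f_def y\<rho> algebra_simps)
        next
          case False
          then show ?thesis using tangent_nonsmooth[OF vector_fieldsD(1)[OF Z]] by (simp add: E_def)
        qed
        then show "Z q g = ((\<Sum>b\<in>Basis. f b \<odot> E b) + k \<odot> Z) q g"
          by (simp add: sum_fun_apply fscale_apply scaleR_fun_apply k_def algebra_simps)
      qed
      ultimately show ?thesis by blast
    qed
  qed
qed

lemma vf_zero: "0 \<in> vector_fields A"
  unfolding vector_fields_def deriv_along_def
  using subspace_0[OF subspace_tangent_space] by (auto simp: smooth_fun_const)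

lemma vf_add: "X \<in> vector_fields A \<Longrightarrow> Y \<in> vector_fields A \<Longrightarrow> X + Y \<in> vector_fields A"
  using subspace_add[OF subspace_tangent_space] unfolding vector_fields_def deriv_along_def
  by (auto intro: smooth_fun_add)

lemma vf_scale: "smooth_fun A f \<Longrightarrow> X \<in> vector_fields A \<Longrightarrow> f \<odot> X \<in> vector_fields A"
  using subspace_scale[OF subspace_tangent_space] unfolding vector_fields_def deriv_along_def
  by (auto intro: smooth_fun_mult simp: fscale_apply scaleR_fun_apply)

lemma vf_scaleR: "X \<in> vector_fields A \<Longrightarrow> a *\<^sub>R X \<in> vector_fields A"
  using vf_scale[OF smooth_fun_const[of a]] by (simp add: fscale_def scaleR_fun_def)

lemma vf_minus: "X \<in> vector_fields A \<Longrightarrow> - X \<in> vector_fields A"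
  using vf_scaleR[of X "-1"] by simp

lemma vf_diff: "X \<in> vector_fields A \<Longrightarrow> Y \<in> vector_fields A \<Longrightarrow> X - Y \<in> vector_fields A"
  using vf_add[OF _ vf_minus, of X Y] by simp

lemma vf_sum: "(\<And>i. i \<in> I \<Longrightarrow> X i \<in> vector_fields A) \<Longrightarrow> (\<Sum>i\<in>I. X i) \<in> vector_fields A"
  by (induction I rule: infinite_finite_induct) (auto intro: vf_zero vf_add)

lemma extend_tvec:
  assumes "v \<in> tangent_space A p"
  shows "extend_tvec A p v \<in> vector_fields A" "extend_tvec A p v p = v"
proof -
  obtain E :: "'e \<Rightarrow> 'm vfield" where E: "\<And>b. E b \<in> vector_fields A"
      "\<And>v. v \<in> tangent_space A p \<Longrightarrow> \<exists>a. v = (\<Sum>b\<in>Basis. a b *\<^sub>R E b p)"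
    by (rule local_frame[of p]) blast
  from E(2)[OF assms] obtain a where a: "v = (\<Sum>b\<in>Basis. a b *\<^sub>R E b p)" ..
  define X where "X = (\<Sum>b\<in>Basis. a b *\<^sub>R E b)"
  have "X \<in> vector_fields A" unfolding X_def by (intro vf_sum vf_scaleR E)
  moreover have "X p = v" by (simp add: X_def a sum_fun_apply scaleR_fun_apply)
  ultimately have "\<exists>X. X \<in> vector_fields A \<and> X p = v" by blast
  from someI_ex[OF this] show "extend_tvec A p v \<in> vector_fields A" "extend_tvec A p v p = v"
    unfolding extend_tvec_def by auto
qed

lemma tangent_space_basis:
  obtains S where "finite S" "independent S" "span S = tangent_space A p" "card S = DIM('e)"
proof -
  obtain E :: "'e \<Rightarrow> 'm vfield" where E: "\<And>b. E b \<in> vector_fields A"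
      "\<And>v. v \<in> tangent_space A p \<Longrightarrow> \<exists>a. v = (\<Sum>b\<in>Basis. a b *\<^sub>R E b p)"
      "\<And>a j. (\<Sum>b\<in>Basis. a b *\<^sub>R E b p) = 0 \<Longrightarrow> j \<in> Basis \<Longrightarrow> a j = 0"
    by (rule local_frame[of p]) blast
  let ?e = "\<lambda>b. E b p"
  have inj: "inj_on ?e Basis"
  proof (rule inj_onI, rule ccontr)
    fix i j :: 'e assume ij: "i \<in> Basis" "j \<in> Basis" "E i p = E j p" "i \<noteq> j"
    have "(\<Sum>b\<in>Basis. (if b = i then 1 else if b = j then -1 else 0) *\<^sub>R E b p)
      = (\<Sum>b\<in>Basis. (if b = i then E i p else 0) + (if b = j then - E j p else 0))"
      using ij(4) by (intro sum.cong) auto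
    also have "\<dots> = 0" using ij by (simp add: sum.distrib)
    finally show False using E(3)[of "\<lambda>b. if b = i then 1 else if b = j then -1 else 0" i] ij by simp
  qed
  have zero: "f x = 0" if f: "(\<Sum>x\<in>?e ` Basis. f x *\<^sub>R x) = 0" and x: "x \<in> ?e ` Basis" for f x
  proof -
    obtain j where j: "j \<in> Basis" "x = E j p" using x by auto
    have "(\<Sum>b\<in>Basis. f (E b p) *\<^sub>R E b p) = 0" using f by (simp add: sum.reindex[OF inj])
    then have "f (E j p) = 0" by (rule E(3)[of "\<lambda>b. f (E b p)", OF _ j(1)])
    then show ?thesis by (simp add: j(2))
  qed
  have "independent (?e ` Basis)"
    apply (rule independent_if_scalars_zero)
     apply simp
    subgoal for f x by (rule zero[of f x])
    done
  moreover have "span (?e ` Basis) = tangent_space A p"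
  proof (intro equalityI subsetI)
    fix v assume "v \<in> tangent_space A p"
    then obtain a where v: "v = (\<Sum>b\<in>Basis. a b *\<^sub>R E b p)" using E(2) by blast
    show "v \<in> span (?e ` Basis)" unfolding v by (intro span_sum span_scale span_base imageI)
  next
    fix v assume "v \<in> span (?e ` Basis)"
    moreover have "span (?e ` Basis) \<subseteq> tangent_space A p"
      by (intro span_minimal subspace_tangent_space image_subsetI vector_fieldsD(1) E(1))
    ultimately show "v \<in> tangent_space A p" by (rule rev_subsetD)
  qed
  ultimately show thesis using that card_image[OF inj] by (metis finite_Basis finite_imageI)
qed

text \<open>By \<open>local_frame\<close> a field vanishing at \<open>p\<close> is a combination of global fields, itself among
  them, with coefficients vanishing at \<open>p\<close>; an operator that is linear over the smooth functions lets
  the coefficients through.\<close>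

lemma tensorial_at:
  fixes F :: "'m vfield \<Rightarrow> 'm vfield"
  assumes add: "\<And>X Y. X \<in> vector_fields A \<Longrightarrow> Y \<in> vector_fields A \<Longrightarrow> F (X + Y) = F X + F Y"
    and scale: "\<And>f X. smooth_fun A f \<Longrightarrow> X \<in> vector_fields A \<Longrightarrow> F (f \<odot> X) = f \<odot> F X"
    and XY: "X \<in> vector_fields A" "Y \<in> vector_fields A" "X p = Y p"
  shows "F X p = F Y p"
proof -
  obtain E :: "'e \<Rightarrow> 'm vfield" and k where E: "\<And>b. E b \<in> vector_fields A" "smooth_fun A k" "k p = 0"
    "\<And>Z. Z \<in> vector_fields A \<Longrightarrow>
      \<exists>f. (\<forall>b. smooth_fun A (f b)) \<and> Z = (\<Sum>b\<in>Basis. f b \<odot> E b) + k \<odot> Z"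
    "\<And>a j. (\<Sum>b\<in>Basis. a b *\<^sub>R E b p) = 0 \<Longrightarrow> j \<in> Basis \<Longrightarrow> a j = 0"
    by (rule local_frame[of p]) blast
  define Z where "Z = X - Y"
  have Z: "Z \<in> vector_fields A" "Z p = 0" using XY by (auto simp: Z_def vf_diff)
  obtain f where f: "\<And>b. smooth_fun A (f b)" "Z = (\<Sum>b\<in>Basis. f b \<odot> E b) + k \<odot> Z"
    using E(4)[OF Z(1)] by blast
  have "(\<Sum>b\<in>Basis. f b p *\<^sub>R E b p) = 0"
    using fun_cong[OF f(2), of p] Z(2) E(3) by (simp add: sum_fun_apply fscale_apply)
  then have f0: "f b p = 0" if "b \<in> Basis" for b using E(5)[of "\<lambda>b. f b p"] that by blast
  have F0: "F 0 = 0" using add[OF vf_zero vf_zero] by simp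
  have Fsum: "F (\<Sum>b\<in>I. f b \<odot> E b) = (\<Sum>b\<in>I. f b \<odot> F (E b))" for I
  proof (induction I rule: infinite_finite_induct)
    case (insert b I)
    have "F (f b \<odot> E b + (\<Sum>b\<in>I. f b \<odot> E b)) = F (f b \<odot> E b) + F (\<Sum>b\<in>I. f b \<odot> E b)"
      by (intro add vf_sum vf_scale f E)
    then show ?case
      by (simp only: sum.insert[OF insert.hyps] insert.IH scale[OF f(1) E(1)])
  qed (simp_all only: sum.infinite sum.empty F0 not_False_eq_True)
  have "F Z = F ((\<Sum>b\<in>Basis. f b \<odot> E b) + k \<odot> Z)" using f(2) by simp
  also have "\<dots> = F (\<Sum>b\<in>Basis. f b \<odot> E b) + F (k \<odot> Z)"
    by (intro add vf_sum vf_scale f E Z)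
  also have "\<dots> = (\<Sum>b\<in>Basis. f b \<odot> F (E b)) + k \<odot> F Z"
    by (simp add: Fsum scale E(2) Z(1))
  finally have "F Z p = ((\<Sum>b\<in>Basis. f b \<odot> F (E b)) + k \<odot> F Z) p" by simp
  also have "\<dots> = 0" by (simp add: sum_fun_apply fscale_apply f0 E(3))
  finally have "F Z p = 0" .
  moreover have "F X = F Z + F Y" using add[OF Z(1) XY(2)] by (simp add: Z_def)
  ultimately show ?thesis by simp
qed

end

section \<open>Lie brackets\<close>

lemma fscale_diff_right: "f \<odot> (X - Y) = f \<odot> X - f \<odot> Y"
  by (simp add: fscale_def fun_eq_iff scaleR_fun_apply algebra_simps)

lemma lie_bracket_skew: "lie_bracket X Y = - lie_bracket Y X"
  by (simp add: lie_bracket_def fun_eq_iff)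

context smooth_manifold
begin

lemma tangent_zero_fun: "v \<in> tangent_space A p \<Longrightarrow> v (\<lambda>x. 0) = 0"
  using tangent_const[of v p 0] .

lemma deriv_along_nonsmooth:
  "X \<in> vector_fields A \<Longrightarrow> \<not> smooth_fun A f \<Longrightarrow> deriv_along X f = (\<lambda>x. 0)"
  using tangent_nonsmooth vector_fieldsD(1) by (fastforce simp: deriv_along_def)

lemma vfield_eqI:
  assumes "X \<in> vector_fields A" "Y \<in> vector_fields A"
    and "\<And>p f. smooth_fun A f \<Longrightarrow> X p f = Y p f"
  shows "X = Y"
proof (intro ext)
  fix p f
  show "X p f = Y p f"
    using assms(3)[of f p] tangent_nonsmooth[OF vector_fieldsD(1)[OF assms(1)]]
      tangent_nonsmooth[OF vector_fieldsD(1)[OF assms(2)]]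
    by (cases "smooth_fun A f") auto
qed

lemma vf_bracket:
  assumes X: "X \<in> vector_fields A" and Y: "Y \<in> vector_fields A"
  shows "lie_bracket X Y \<in> vector_fields A"
  unfolding vector_fields_def
proof (intro CollectI conjI allI impI)
  note XT = vector_fieldsD(1)[OF X] and YT = vector_fieldsD(1)[OF Y]
  have dX: "smooth_fun A (\<lambda>p. X p f)" and dY: "smooth_fun A (\<lambda>p. Y p f)" if "smooth_fun A f" for f
    using that vector_fieldsD(2)[OF X] vector_fieldsD(2)[OF Y] by (auto simp: deriv_along_def)
  show "smooth_fun A (deriv_along (lie_bracket X Y) f)" if f: "smooth_fun A f" for f
    using smooth_fun_diff[OF dX[OF dY[OF f]] dY[OF dX[OF f]]]
    by (simp add: deriv_along_def lie_bracket_def)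
  show "lie_bracket X Y p \<in> tangent_space A p" for p
    unfolding tangent_space_def
  proof (intro CollectI conjI allI impI)
    fix f assume "\<not> smooth_fun A f"
    then show "lie_bracket X Y p f = 0"
      using deriv_along_nonsmooth X Y tangent_zero_fun[OF XT] tangent_zero_fun[OF YT]
      by (simp add: lie_bracket_def)
  next
    fix f h :: "'m \<Rightarrow> real" and a b :: real
    assume f: "smooth_fun A f" and h: "smooth_fun A h"
    show "lie_bracket X Y p (\<lambda>x. a * f x + b * h x) = a * lie_bracket X Y p f + b * lie_bracket X Y p h"
      by (simp add: lie_bracket_def deriv_along_def tangent_lin[OF XT f h] tangent_lin[OF YT f h]
          tangent_lin[OF XT dY[OF f] dY[OF h]] tangent_lin[OF YT dX[OF f] dX[OF h]] algebra_simps)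
    have "X p (\<lambda>q. f q * Y q h + h q * Y q f)
        = (f p * X p (\<lambda>q. Y q h) + Y p h * X p f) + (h p * X p (\<lambda>q. Y q f) + Y p f * X p h)"
      using tangent_add[OF XT smooth_fun_mult[OF f dY[OF h]] smooth_fun_mult[OF h dY[OF f]]]
      by (simp add: tangent_mult[OF XT f dY[OF h]] tangent_mult[OF XT h dY[OF f]])
    moreover have "Y p (\<lambda>q. f q * X q h + h q * X q f)
        = (f p * Y p (\<lambda>q. X q h) + X p h * Y p f) + (h p * Y p (\<lambda>q. X q f) + X p f * Y p h)"
      using tangent_add[OF YT smooth_fun_mult[OF f dX[OF h]] smooth_fun_mult[OF h dX[OF f]]]
      by (simp add: tangent_mult[OF YT f dX[OF h]] tangent_mult[OF YT h dX[OF f]])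
    ultimately show "lie_bracket X Y p (\<lambda>x. f x * h x) = f p * lie_bracket X Y p h + h p * lie_bracket X Y p f"
      by (simp add: lie_bracket_def deriv_along_def tangent_mult[OF XT f h] tangent_mult[OF YT f h]
          algebra_simps)
  qed
qed

lemma smooth_deriv: "X \<in> vector_fields A \<Longrightarrow> smooth_fun A f \<Longrightarrow> smooth_fun A (\<lambda>q. X q f)"
  using vector_fieldsD(2) by (simp add: deriv_along_def)

lemma lie_bracket_add_left:
  assumes X: "X \<in> vector_fields A" and Y: "Y \<in> vector_fields A" and Z: "Z \<in> vector_fields A"
  shows "lie_bracket (X + Y) Z = lie_bracket X Z + lie_bracket Y Z"
proof (rule vfield_eqI)
  show "lie_bracket (X + Y) Z p f = (lie_bracket X Z + lie_bracket Y Z) p f"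
    if f: "smooth_fun A f" for p f
    using tangent_add[OF vector_fieldsD(1)[OF Z] smooth_deriv[OF X f] smooth_deriv[OF Y f]]
    by (simp add: lie_bracket_def deriv_along_def)
qed (intro vf_bracket vf_add X Y Z)+

lemma lie_bracket_scale_left:
  assumes f: "smooth_fun A f" and X: "X \<in> vector_fields A" and Z: "Z \<in> vector_fields A"
  shows "lie_bracket (f \<odot> X) Z = f \<odot> lie_bracket X Z - deriv_along Z f \<odot> X"
proof (rule vfield_eqI)
  show "lie_bracket (f \<odot> X) Z p u = (f \<odot> lie_bracket X Z - deriv_along Z f \<odot> X) p u"
    if u: "smooth_fun A u" for p u
    using tangent_mult[OF vector_fieldsD(1)[OF Z] f smooth_deriv[OF X u]]
    by (simp add: lie_bracket_def deriv_along_def fscale_apply scaleR_fun_apply algebra_simps)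
qed (intro vf_bracket vf_diff vf_scale vector_fieldsD(2) f X Z)+

lemma lie_bracket_scale_right:
  assumes f: "smooth_fun A f" and X: "X \<in> vector_fields A" and Z: "Z \<in> vector_fields A"
  shows "lie_bracket Z (f \<odot> X) = f \<odot> lie_bracket Z X + deriv_along Z f \<odot> X"
  by (simp add: lie_bracket_skew[of Z "f \<odot> X"] lie_bracket_skew[of Z X]
      lie_bracket_scale_left[OF f X Z] fun_eq_iff fscale_apply scaleR_fun_apply)

lemma lie_bracket_add_right:
  assumes "X \<in> vector_fields A" "Y \<in> vector_fields A" "Z \<in> vector_fields A"
  shows "lie_bracket Z (X + Y) = lie_bracket Z X + lie_bracket Z Y"
  by (simp add: lie_bracket_skew[of Z "X + Y"] lie_bracket_skew[of Z X] lie_bracket_skew[of Z Y]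
      lie_bracket_add_left[OF assms])

lemma jacobi:
  assumes X: "X \<in> vector_fields A" and Y: "Y \<in> vector_fields A" and Z: "Z \<in> vector_fields A"
  shows "lie_bracket X (lie_bracket Y Z) + lie_bracket Y (lie_bracket Z X)
    + lie_bracket Z (lie_bracket X Y) = 0"
proof (rule vfield_eqI)
  have d: "W p (\<lambda>q. U q (\<lambda>r. V r f) - V q (\<lambda>r. U r f))
      = W p (\<lambda>q. U q (\<lambda>r. V r f)) - W p (\<lambda>q. V q (\<lambda>r. U r f))"
    if "W \<in> vector_fields A" "U \<in> vector_fields A" "V \<in> vector_fields A" "smooth_fun A f" for U V W p f
    by (rule tangent_diff[OF vector_fieldsD(1)[OF that(1)]
          smooth_deriv[OF that(2) smooth_deriv[OF that(3,4)]] smooth_deriv[OF that(3) smooth_deriv[OF that(2,4)]]])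
  show "(lie_bracket X (lie_bracket Y Z) + lie_bracket Y (lie_bracket Z X)
      + lie_bracket Z (lie_bracket X Y)) p f = 0 p f" if f: "smooth_fun A f" for p f
    by (simp add: lie_bracket_def deriv_along_def d[OF X Y Z f] d[OF Y Z X f] d[OF Z X Y f])
qed (intro vf_add vf_bracket vf_zero X Y Z)+

end

section \<open>The Levi-Civita connection and its curvature\<close>

locale riemannian_manifold = smooth_manifold A
  for A :: "('m::{t2_space,second_countable_topology}, 'e::euclidean_space) chart set" +
  fixes g :: "'m form2" and D :: "'m vfield \<Rightarrow> 'm vfield \<Rightarrow> 'm vfield"
  assumes metric: "riemannian_metric A g" and levi_civita: "levi_civita A g D"
begin

lemma connectionD:
  assumes "X \<in> vector_fields A" "Y \<in> vector_fields A"
  shows "D X Y \<in> vector_fields A"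
  using levi_civita assms unfolding levi_civita_def affine_connection_def by blast

lemma connection_rules:
  assumes "X \<in> vector_fields A" "Y \<in> vector_fields A" "Z \<in> vector_fields A"
  shows connection_add_left: "D (X + Y) Z = D X Z + D Y Z"
    and connection_add_right: "D X (Y + Z) = D X Y + D X Z"
    and metric_compatible:
      "deriv_along X (form2_app g Y Z) = form2_app g (D X Y) Z + form2_app g Y (D X Z)"
  using levi_civita assms smooth_fun_const[of 0]
  unfolding levi_civita_def affine_connection_def by blast+

lemma connection_scale:
  assumes "smooth_fun A f" "X \<in> vector_fields A" "Y \<in> vector_fields A"
  shows connection_scale_left: "D (f \<odot> X) Y = f \<odot> D X Y"
    and connection_leibniz: "D X (f \<odot> Y) = deriv_along X f \<odot> Y + f \<odot> D X Y"
  using levi_civita assms unfolding levi_civita_def affine_connection_def by blast+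

lemma torsion_free:
  "X \<in> vector_fields A \<Longrightarrow> Y \<in> vector_fields A \<Longrightarrow> D X Y - D Y X = lie_bracket X Y"
  using levi_civita unfolding levi_civita_def by blast

lemma connection_diff_left:
  assumes "X \<in> vector_fields A" "Y \<in> vector_fields A" "Z \<in> vector_fields A"
  shows "D (X - Y) Z = D X Z - D Y Z"
  using connection_add_left[OF vf_diff[OF assms(1,2)] assms(2,3)] by simp

lemma connection_diff_right:
  assumes "X \<in> vector_fields A" "Y \<in> vector_fields A" "Z \<in> vector_fields A"
  shows "D X (Y - Z) = D X Y - D X Z"
  using connection_add_right[OF assms(1) vf_diff[OF assms(2,3)] assms(3)] by simp

lemma connection_minus_left:
  assumes "X \<in> vector_fields A" "Z \<in> vector_fields A"
  shows "D (- X) Z = - D X Z"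
  using connection_diff_left[OF vf_zero assms] connection_diff_left[OF vf_zero vf_zero assms(2)] by simp

lemma vf_curvature:
  "X \<in> vector_fields A \<Longrightarrow> Y \<in> vector_fields A \<Longrightarrow> Z \<in> vector_fields A \<Longrightarrow>
    curvature D X Y Z \<in> vector_fields A"
  unfolding curvature_def by (intro vf_diff connectionD vf_bracket)

lemma curvature_skew:
  assumes "X \<in> vector_fields A" "Y \<in> vector_fields A" "Z \<in> vector_fields A"
  shows "curvature D X Y Z = - curvature D Y X Z"
proof -
  have "D (lie_bracket X Y) Z = - D (lie_bracket Y X) Z"
    by (subst lie_bracket_skew) (rule connection_minus_left[OF vf_bracket[OF assms(2,1)] assms(3)])
  then show ?thesis by (simp add: curvature_def)
qed

lemma curvature_add1:
  assumes "X \<in> vector_fields A" "X' \<in> vector_fields A" "Y \<in> vector_fields A" "Z \<in> vector_fields A"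
  shows "curvature D (X + X') Y Z = curvature D X Y Z + curvature D X' Y Z"
  using assms
  by (simp add: curvature_def connection_add_left connection_add_right lie_bracket_add_left
      connectionD vf_bracket)

lemma curvature_scale1:
  assumes "smooth_fun A f" "X \<in> vector_fields A" "Y \<in> vector_fields A" "Z \<in> vector_fields A"
  shows "curvature D (f \<odot> X) Y Z = f \<odot> curvature D X Y Z"
  using assms
  by (simp add: curvature_def connection_scale_left connection_leibniz lie_bracket_scale_left
      connection_diff_left connectionD vf_bracket vf_scale vector_fieldsD(2) fscale_diff_right)

lemma curvature_add3:
  assumes "X \<in> vector_fields A" "Y \<in> vector_fields A" "Z \<in> vector_fields A" "Z' \<in> vector_fields A"
  shows "curvature D X Y (Z + Z') = curvature D X Y Z + curvature D X Y Z'"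
  using assms by (simp add: curvature_def connection_add_right connectionD vf_bracket)

lemma curvature_scale3:
  assumes "smooth_fun A f" "X \<in> vector_fields A" "Y \<in> vector_fields A" "Z \<in> vector_fields A"
  shows "curvature D X Y (f \<odot> Z) = f \<odot> curvature D X Y Z"
proof -
  have br: "deriv_along (lie_bracket X Y) f p
      = deriv_along X (deriv_along Y f) p - deriv_along Y (deriv_along X f) p" for p
    by (simp add: deriv_along_def lie_bracket_def)
  show ?thesis
    using assms
    by (simp add: br curvature_def connection_add_right connection_leibniz connectionD vf_bracket vf_scale
       vector_fieldsD(2) fun_eq_iff fscale_apply scaleR_fun_apply algebra_simps)
qed

lemma curvature_add2:
  assumes "X \<in> vector_fields A" "Y \<in> vector_fields A" "Y' \<in> vector_fields A" "Z \<in> vector_fields A"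
  shows "curvature D X (Y + Y') Z = curvature D X Y Z + curvature D X Y' Z"
  using assms curvature_skew[of X "Y + Y'" Z] curvature_skew[of X Y Z] curvature_skew[of X Y' Z]
  by (simp add: curvature_add1 vf_add)

lemma curvature_scale2:
  assumes "smooth_fun A f" "X \<in> vector_fields A" "Y \<in> vector_fields A" "Z \<in> vector_fields A"
  shows "curvature D X (f \<odot> Y) Z = f \<odot> curvature D X Y Z"
  using assms curvature_skew[of X "f \<odot> Y" Z] curvature_skew[of X Y Z]
  by (simp add: curvature_scale1 vf_scale fun_eq_iff fscale_apply scaleR_fun_apply)

text \<open>Vanishing torsion collects the second covariant derivatives into iterated brackets, so that the
  cyclic sum is the one in the Jacobi identity.\<close>

lemma bianchi:
  assumes X: "X \<in> vector_fields A" and Y: "Y \<in> vector_fields A" and Z: "Z \<in> vector_fields A"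
  shows "curvature D X Y Z + curvature D Y Z X + curvature D Z X Y = 0"
proof -
  have cyc: "D U (D V W) - D U (D W V) - D (lie_bracket V W) U = lie_bracket U (lie_bracket V W)"
    if "U \<in> vector_fields A" "V \<in> vector_fields A" "W \<in> vector_fields A" for U V W
    using that
    by (simp flip: connection_diff_right add: torsion_free connectionD vf_bracket)
  have "curvature D X Y Z + curvature D Y Z X + curvature D Z X Y
     = (D X (D Y Z) - D X (D Z Y) - D (lie_bracket Y Z) X)
     + (D Y (D Z X) - D Y (D X Z) - D (lie_bracket Z X) Y)
     + (D Z (D X Y) - D Z (D Y X) - D (lie_bracket X Y) Z)"
    by (simp add: curvature_def algebra_simps)
  also have "\<dots> = 0" using X Y Z by (simp only: cyc jacobi)
  finally show ?thesis .
qed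

lemma metric_smooth: "X \<in> vector_fields A \<Longrightarrow> Y \<in> vector_fields A \<Longrightarrow> smooth_fun A (form2_app g X Y)"
  using metric unfolding riemannian_metric_def by blast

lemma metric_sym: "u \<in> tangent_space A p \<Longrightarrow> v \<in> tangent_space A p \<Longrightarrow> g p u v = g p v u"
  using metric unfolding riemannian_metric_def by blast

lemma metric_lin_right:
  "u \<in> tangent_space A p \<Longrightarrow> v \<in> tangent_space A p \<Longrightarrow> w \<in> tangent_space A p \<Longrightarrow>
    g p u (a *\<^sub>R v + b *\<^sub>R w) = a * g p u v + b * g p u w"
  using metric unfolding riemannian_metric_def linear_on_space_def by auto

lemma metric_pos: "u \<in> tangent_space A p \<Longrightarrow> u \<noteq> 0 \<Longrightarrow> g p u u > 0"
  using metric unfolding riemannian_metric_def by blast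

lemma metric_add_left:
  "u \<in> tangent_space A p \<Longrightarrow> v \<in> tangent_space A p \<Longrightarrow> w \<in> tangent_space A p \<Longrightarrow>
    g p (u + v) w = g p u w + g p v w"
  using metric_lin_right[of w p u v 1 1] metric_sym subspace_add[OF subspace_tangent_space]
  by (metis mult_1 scaleR_one)

lemma metric_diff_left:
  "u \<in> tangent_space A p \<Longrightarrow> v \<in> tangent_space A p \<Longrightarrow> w \<in> tangent_space A p \<Longrightarrow>
    g p (u - v) w = g p u w - g p v w"
  using metric_add_left[of "u - v" p v w] subspace_diff[OF subspace_tangent_space] by fastforce

text \<open>Differentiate \<open>g Z W\<close> twice: metric compatibility makes the commutator of the derivations \<open>X\<close>
  and \<open>Y\<close>, minus the derivation \<open>[X, Y]\<close>, act on it as \<open>g (R Z) W + g Z (R W)\<close>, and this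
  difference is zero.\<close>

lemma curvature_metric_skew:
  assumes X: "X \<in> vector_fields A" and Y: "Y \<in> vector_fields A" and Z: "Z \<in> vector_fields A"
    and W: "W \<in> vector_fields A"
  shows "g p (curvature D X Y Z p) (W p) = - g p (curvature D X Y W p) (Z p)"
proof -
  note T = vector_fieldsD(1)
  have first: "(\<lambda>q. U q (form2_app g Z W)) = (\<lambda>q. form2_app g (D U Z) W q + form2_app g Z (D U W) q)"
    if "U \<in> vector_fields A" for U
    using metric_compatible[OF that Z W] by (simp add: deriv_along_def fun_eq_iff)
  have second: "V p (deriv_along U (form2_app g Z W))
      = g p (D V (D U Z) p) (W p) + g p (D U Z p) (D V W p)
      + g p (D V Z p) (D U W p) + g p (Z p) (D V (D U W) p)"
    if U: "U \<in> vector_fields A" and V: "V \<in> vector_fields A" for U V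
  proof -
    have *: "V p (form2_app g M N) = g p (D V M p) (N p) + g p (M p) (D V N p)"
      if "M \<in> vector_fields A" "N \<in> vector_fields A" for M N
      using fun_cong[OF metric_compatible[OF V that], of p] by (simp add: deriv_along_def form2_app_def)
    have "V p (deriv_along U (form2_app g Z W))
        = V p (form2_app g (D U Z) W) + V p (form2_app g Z (D U W))"
      unfolding deriv_along_def first[OF U]
      by (rule tangent_add[OF T[OF V] metric_smooth[OF connectionD[OF U Z] W]
            metric_smooth[OF Z connectionD[OF U W]]])
    then show ?thesis using * U Z W by (simp add: connectionD)
  qed
  have "lie_bracket X Y p (form2_app g Z W)
      = g p (D (lie_bracket X Y) Z p) (W p) + g p (Z p) (D (lie_bracket X Y) W p)"
    using fun_cong[OF first[OF vf_bracket[OF X Y]], of p] by (simp add: form2_app_def)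
  then have "g p (D X (D Y Z) p) (W p) - g p (D Y (D X Z) p) (W p) - g p (D (lie_bracket X Y) Z p) (W p)
      = - (g p (Z p) (D X (D Y W) p) - g p (Z p) (D Y (D X W) p) - g p (Z p) (D (lie_bracket X Y) W p))"
    by (simp add: lie_bracket_def[of X Y] second[OF X Y] second[OF Y X])
  moreover have "g p (curvature D X Y U p) (V p)
      = g p (D X (D Y U) p) (V p) - g p (D Y (D X U) p) (V p) - g p (D (lie_bracket X Y) U p) (V p)"
    if "U \<in> vector_fields A" "V \<in> vector_fields A" for U V
    using that X Y by (simp add: curvature_def metric_diff_left T connectionD vf_bracket
        subspace_diff[OF subspace_tangent_space])
  ultimately show ?thesis
    using X Y Z W by (simp add: metric_sym[OF T[OF Z]] T connectionD vf_bracket)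
qed

lemma curvature_at_eq:
  assumes X: "X \<in> vector_fields A" and Y: "Y \<in> vector_fields A" and Z: "Z \<in> vector_fields A"
  shows "curvature D X Y Z p = curvature_at A D p (X p) (Y p) (Z p)"
proof -
  let ?X = "extend_tvec A p (X p)" and ?Y = "extend_tvec A p (Y p)" and ?Z = "extend_tvec A p (Z p)"
  note x = extend_tvec[OF vector_fieldsD(1)[OF X, of p]]
    and y = extend_tvec[OF vector_fieldsD(1)[OF Y, of p]]
    and z = extend_tvec[OF vector_fieldsD(1)[OF Z, of p]]
  have "curvature D X Y Z p = curvature D ?X Y Z p"
    by (rule tensorial_at[of "\<lambda>X. curvature D X Y Z"])
      (simp_all add: curvature_add1 curvature_scale1 X Y Z x)
  also have "\<dots> = curvature D ?X ?Y Z p"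
    by (rule tensorial_at[of "\<lambda>Y. curvature D ?X Y Z"])
      (simp_all add: curvature_add2 curvature_scale2 Y Z x y)
  also have "\<dots> = curvature D ?X ?Y ?Z p"
    by (rule tensorial_at[of "\<lambda>Z. curvature D ?X ?Y Z"])
      (simp_all add: curvature_add3 curvature_scale3 Z x y z)
  finally show ?thesis by (simp add: curvature_at_def)
qed

end

section \<open>Traces and curvature forms on an inner product space\<close>

text \<open>The inner product lives on a subspace of a real vector space, because the tangent spaces are
  subspaces of the space of all functionals on functions.\<close>

locale inner_product_on =
  fixes V :: "'a::real_vector set" and G :: "'a \<Rightarrow> 'a \<Rightarrow> real"
  assumes V: "subspace V"
    and sym: "x \<in> V \<Longrightarrow> y \<in> V \<Longrightarrow> G x y = G y x"
    and lin: "x \<in> V \<Longrightarrow> y \<in> V \<Longrightarrow> z \<in> V \<Longrightarrow> G x (a *\<^sub>R y + b *\<^sub>R z) = a * G x y + b * G x z"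
    and pos: "x \<in> V \<Longrightarrow> x \<noteq> 0 \<Longrightarrow> G x x > 0"
begin

lemma lincomb_closed: "x \<in> V \<Longrightarrow> y \<in> V \<Longrightarrow> a *\<^sub>R x + b *\<^sub>R y \<in> V"
  using V by (simp add: subspace_add subspace_scale)

lemma lin_left:
  "x \<in> V \<Longrightarrow> y \<in> V \<Longrightarrow> z \<in> V \<Longrightarrow> G (a *\<^sub>R x + b *\<^sub>R y) z = a * G x z + b * G y z"
  using lin[of z x y a b] sym lincomb_closed by simp

lemma add_left: "x \<in> V \<Longrightarrow> y \<in> V \<Longrightarrow> z \<in> V \<Longrightarrow> G (x + y) z = G x z + G y z"
  using lin_left[of x y z 1 1] by simp

lemma diff_left: "x \<in> V \<Longrightarrow> y \<in> V \<Longrightarrow> z \<in> V \<Longrightarrow> G (x - y) z = G x z - G y z"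
  using lin_left[of x y z 1 "-1"] by simp

lemma scale_left: "x \<in> V \<Longrightarrow> z \<in> V \<Longrightarrow> G (a *\<^sub>R x) z = a * G x z"
  using lin_left[of x x z a 0] by simp

lemma zero_left: "z \<in> V \<Longrightarrow> G 0 z = 0"
  using scale_left[of 0 z 0] subspace_0[OF V] by simp

lemma sum_left:
  assumes "\<And>i. i \<in> I \<Longrightarrow> f i \<in> V" "z \<in> V"
  shows "G (\<Sum>i\<in>I. f i) z = (\<Sum>i\<in>I. G (f i) z)"
  using assms(1)
proof (induction I rule: infinite_finite_induct)
  case (insert i I)
  then show ?case using assms(2) by (simp add: add_left subspace_sum[OF V])
qed (simp_all add: zero_left assms(2))

lemma nondegenerate:
  assumes "x \<in> V" "y \<in> V" "\<And>w. w \<in> V \<Longrightarrow> G x w = G y w"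
  shows "x = y"
proof -
  have d: "x - y \<in> V" using assms(1,2) V by (simp add: subspace_diff)
  have "G (x - y) (x - y) = 0" using diff_left[OF assms(1,2) d] assms(3)[OF d] by simp
  then show ?thesis using pos[OF d] by fastforce
qed

definition orthonormal :: "'a set \<Rightarrow> bool"
  where "orthonormal B \<longleftrightarrow> finite B \<and> B \<subseteq> V \<and>
    (\<forall>b\<in>B. \<forall>c\<in>B. G b c = (if b = c then 1 else 0))"

lemma orthonormal_coeff:
  assumes "orthonormal B" "b \<in> B"
  shows "G (\<Sum>c\<in>B. f c *\<^sub>R c) b = f b"
proof -
  have B: "finite B" "B \<subseteq> V" "\<And>c. c \<in> B \<Longrightarrow> G c b = (if c = b then 1 else 0)"
    using assms by (auto simp: orthonormal_def)
  have b: "b \<in> V" using assms(2) B by auto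
  have "G (\<Sum>c\<in>B. f c *\<^sub>R c) b = (\<Sum>c\<in>B. G (f c *\<^sub>R c) b)"
    using B(2) b by (intro sum_left) (auto intro: subspace_scale[OF V])
  also have "\<dots> = (\<Sum>c\<in>B. if c = b then f c else 0)"
    using B b by (intro sum.cong) (auto simp: scale_left subset_iff)
  finally show ?thesis using B(1) assms(2) by simp
qed

lemma orthonormal_independent:
  assumes "orthonormal B"
  shows "independent B"
  unfolding independent_explicit_module
proof (intro allI impI)
  fix t u v assume t: "finite t" "t \<subseteq> B" and s: "(\<Sum>v\<in>t. u v *\<^sub>R v) = 0" and v: "v \<in> t"
  have "orthonormal t" using assms t by (auto simp: orthonormal_def subset_iff)
  then have "G 0 v = u v" using orthonormal_coeff[of t v u] v s by simp
  then show "u v = 0" using zero_left[of v] assms t v by (auto simp: orthonormal_def)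
qed

lemma orthonormal_span:
  assumes "orthonormal B" "finite S" "span S = V" "card B = card S"
  shows "span B = V"
proof
  show "span B \<subseteq> V" using assms(1) V by (intro span_minimal) (auto simp: orthonormal_def)
  show "V \<subseteq> span B"
  proof (rule ccontr)
    assume "\<not> V \<subseteq> span B"
    then obtain x where x: "x \<in> V" "x \<notin> span B" by auto
    have "independent (insert x B)"
      using x orthonormal_independent[OF assms(1)] by (simp add: independent_insertI)
    moreover have "insert x B \<subseteq> span S" using x assms by (auto simp: orthonormal_def)
    ultimately have "card (insert x B) \<le> card S" using independent_span_bound[OF assms(2)] by blast
    moreover have "x \<notin> B" using x(2) span_base by blast
    ultimately show False using assms by (auto simp: orthonormal_def)
  qed
qed

lemma orthonormal_expand:
  assumes "orthonormal B" "span B = V" "x \<in> V"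
  shows "x = (\<Sum>b\<in>B. G x b *\<^sub>R b)"
proof -
  have "finite B" using assms(1) by (simp add: orthonormal_def)
  then obtain u where u: "x = (\<Sum>b\<in>B. u b *\<^sub>R b)"
    using assms(2,3) by (auto simp: span_finite)
  have "G x b = u b" if "b \<in> B" for b unfolding u by (rule orthonormal_coeff[OF assms(1) that])
  then show ?thesis using u by simp
qed

text \<open>Both expansions, of the elements of the unknown basis in the orthonormal one and of the images of
  the latter in the unknown basis, are inserted; exchanging the two sums eliminates the unknown
  basis.\<close>

lemma trace_orthonormal:
  assumes B: "orthonormal B" "span B = V" and L: "linear_on_space V L" "L ` V \<subseteq> V"
  shows "trace_on V L = (\<Sum>b\<in>B. G (L b) b)"
proof -
  define C where "C = (SOME C. independent C \<and> span C = V)"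
  obtain C' where "C' \<subseteq> V" "independent C'" "V \<subseteq> span C'" by (rule maximal_independent_subset)
  moreover from this have "span C' \<subseteq> V" by (simp add: V span_minimal)
  ultimately have "\<exists>C. independent C \<and> span C = V" by blast
  from someI_ex[OF this] have C: "independent C" "span C = V" by (simp_all add: C_def)
  have finB: "finite B" "B \<subseteq> V" using B(1) by (auto simp: orthonormal_def)
  have CV: "C \<subseteq> V" using C(2) span_base by blast
  have finC: "finite C" using independent_span_bound[OF finB(1) C(1)] CV B(2) by simp
  have LV: "L x \<in> V" if "x \<in> V" for x using L(2) that by auto
  have "L (0 *\<^sub>R 0 + 0 *\<^sub>R 0) = 0 *\<^sub>R L 0 + 0 *\<^sub>R L 0"
    using L(1) subspace_0[OF V] unfolding linear_on_space_def by blast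
  then have L0: "L 0 = 0" by simp
  have Lsum: "L (\<Sum>b\<in>I. f b *\<^sub>R b) = (\<Sum>b\<in>I. f b *\<^sub>R L b)" if "I \<subseteq> V" for I f
    using that
  proof (induction I rule: infinite_finite_induct)
    case (insert x I)
    have "(\<Sum>b\<in>I. f b *\<^sub>R b) \<in> V"
      using insert.prems by (intro subspace_sum[OF V] subspace_scale[OF V]) auto
    then have "L (f x *\<^sub>R x + 1 *\<^sub>R (\<Sum>b\<in>I. f b *\<^sub>R b)) = f x *\<^sub>R L x + 1 *\<^sub>R L (\<Sum>b\<in>I. f b *\<^sub>R b)"
      using L(1) insert.prems unfolding linear_on_space_def by blast
    then show ?case using insert by simp
  qed (simp_all add: L0)
  have rep: "representation C (L c) c = (\<Sum>b\<in>B. G c b * representation C (L b) c)" if "c \<in> C" for c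
  proof -
    have c: "c = (\<Sum>b\<in>B. G c b *\<^sub>R b)"
      by (rule orthonormal_expand[OF B]) (use that CV in blast)
    have "L c = L (\<Sum>b\<in>B. G c b *\<^sub>R b)" by (rule arg_cong[OF c])
    also have "\<dots> = (\<Sum>b\<in>B. G c b *\<^sub>R L b)" by (rule Lsum[OF finB(2)])
    finally have "L c = (\<Sum>b\<in>B. G c b *\<^sub>R L b)" .
    moreover have "representation C (\<Sum>b\<in>B. G c b *\<^sub>R L b) = (\<lambda>d. \<Sum>b\<in>B. representation C (G c b *\<^sub>R L b) d)"
      unfolding C(2) using C LV finB(2)
      by (intro representation_sum[OF C(1)]) (auto simp: C(2) intro!: subspace_scale[OF V])
    ultimately show ?thesis
      using C LV finB(2) by (simp add: representation_scale subset_iff)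
  qed
  have "trace_on V L = (\<Sum>c\<in>C. representation C (L c) c)"
    by (simp add: trace_on_def C_def Let_def)
  also have "\<dots> = (\<Sum>c\<in>C. \<Sum>b\<in>B. G c b * representation C (L b) c)" by (simp add: rep)
  also have "\<dots> = (\<Sum>b\<in>B. \<Sum>c\<in>C. G c b * representation C (L b) c)" by (rule sum.swap)
  also have "\<dots> = (\<Sum>b\<in>B. G (L b) b)"
  proof (rule sum.cong)
    fix b assume b: "b \<in> B"
    have bV: "b \<in> V" using b finB by auto
    have "L b = (\<Sum>c\<in>C. representation C (L b) c *\<^sub>R c)"
      using sum_representation_eq[OF C(1) _ finC] C(2) LV[OF bV] by simp
    then have "G (L b) b = G (\<Sum>c\<in>C. representation C (L b) c *\<^sub>R c) b" by simp
    also have "\<dots> = (\<Sum>c\<in>C. G (representation C (L b) c *\<^sub>R c) b)"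
      using CV bV by (intro sum_left) (auto intro: subspace_scale[OF V])
    also have "\<dots> = (\<Sum>c\<in>C. G c b * representation C (L b) c)"
      using CV bV by (intro sum.cong) (auto simp: scale_left)
    finally show "(\<Sum>c\<in>C. G c b * representation C (L b) c) = G (L b) b" by simp
  qed simp
  finally show ?thesis .
qed

lemma orthonormal_three:
  assumes "a \<in> V" "b \<in> V" "c \<in> V" "G a a = 1" "G b b = 1" "G c c = 1"
    "G a b = 0" "G a c = 0" "G b c = 0"
  shows "orthonormal {a, b, c}" "a \<noteq> b" "a \<noteq> c" "b \<noteq> c"
  using assms sym unfolding orthonormal_def by auto

text \<open>The alternating forms on a three-dimensional space with \<open>z\<close> in the radical form a line,
  on which the value on the plane orthogonal to \<open>z\<close> is a coordinate.\<close>

lemma alternating_form_zero: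
  fixes f :: "'a \<Rightarrow> 'a \<Rightarrow> real"
  assumes B: "orthonormal {a, b, z}" "span {a, b, z} = V" "a \<noteq> b" "a \<noteq> z" "b \<noteq> z"
    and lin: "\<And>x x' y s t. x \<in> V \<Longrightarrow> x' \<in> V \<Longrightarrow> y \<in> V \<Longrightarrow> f (s *\<^sub>R x + t *\<^sub>R x') y = s * f x y + t * f x' y"
    and skew: "\<And>x y. x \<in> V \<Longrightarrow> y \<in> V \<Longrightarrow> f x y = - f y x"
    and radical: "\<And>y. y \<in> V \<Longrightarrow> f z y = 0" and plane: "f a b = 0"
    and xy: "x \<in> V" "y \<in> V"
  shows "f x y = 0"
proof -
  have abz: "a \<in> V" "b \<in> V" "z \<in> V" using B(1) by (auto simp: orthonormal_def)
  have f_exp: "f x y = G x a * f a y + G x b * f b y" if "x \<in> V" "y \<in> V" for x y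
  proof -
    have "x = G x a *\<^sub>R a + 1 *\<^sub>R (G x b *\<^sub>R b + G x z *\<^sub>R z)"
      using orthonormal_expand[OF B(1,2) that(1)] B(3-5) by simp
    then have "f x y = f (G x a *\<^sub>R a + 1 *\<^sub>R (G x b *\<^sub>R b + G x z *\<^sub>R z)) y" by simp
    also have "\<dots> = G x a * f a y + (G x b * f b y + G x z * f z y)"
      using that abz by (simp only: lin lincomb_closed mult_1)
    finally show ?thesis using radical that by simp
  qed
  have ab: "f a a = 0" "f b b = 0" "f b a = 0"
    using skew[of a a] skew[of b b] skew[of b a] plane abz by auto
  have "f a y = 0" "f b y = 0"
    using skew[OF abz(1) xy(2)] skew[OF abz(2) xy(2)] f_exp[OF xy(2) abz(1)] f_exp[OF xy(2) abz(2)] ab plane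
    by auto
  then show ?thesis using f_exp[OF xy] by simp
qed

text \<open>In dimension three a form with the symmetries of a curvature tensor is determined by its values
  with third argument \<open>z\<close> and by the sectional curvature \<open>K\<close> of the plane orthogonal to \<open>z\<close>. The
  right-hand side is the Kulkarni-Nomizu product of the metric with the symmetric form
  \<open>K/2 g - (K - k) \<eta>\<otimes>\<eta> + p\<close>, where \<open>\<eta> = g(\<sqdot>, z)\<close>; hence it has the same symmetries. It has the
  required values: for third argument \<open>z\<close> by the definition of \<open>p\<close>, and on the plane
  because, by the assumption on the trace, \<open>p\<close> has trace zero. The difference \<open>S\<close> of both sides is therefore alternating in each pair with
  \<open>z\<close> in the radical, and vanishes on the plane.\<close>

lemma curvature_form_dim3:
  fixes r :: "'a \<Rightarrow> 'a \<Rightarrow> 'a \<Rightarrow> 'a \<Rightarrow> real"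
  assumes B: "orthonormal {a, b, z}" "span {a, b, z} = V" "a \<noteq> b" "a \<noteq> z" "b \<noteq> z"
    and lin1: "\<And>x x' y u v s t. x \<in> V \<Longrightarrow> x' \<in> V \<Longrightarrow> y \<in> V \<Longrightarrow> u \<in> V \<Longrightarrow> v \<in> V \<Longrightarrow>
      r (s *\<^sub>R x + t *\<^sub>R x') y u v = s * r x y u v + t * r x' y u v"
    and skew12: "\<And>x y u v. x \<in> V \<Longrightarrow> y \<in> V \<Longrightarrow> u \<in> V \<Longrightarrow> v \<in> V \<Longrightarrow> r x y u v = - r y x u v"
    and skew34: "\<And>x y u v. x \<in> V \<Longrightarrow> y \<in> V \<Longrightarrow> u \<in> V \<Longrightarrow> v \<in> V \<Longrightarrow> r x y u v = - r x y v u"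
    and pair: "\<And>x y u v. x \<in> V \<Longrightarrow> y \<in> V \<Longrightarrow> u \<in> V \<Longrightarrow> v \<in> V \<Longrightarrow> r x y u v = r u v x y"
    and rz: "\<And>x y v. x \<in> V \<Longrightarrow> y \<in> V \<Longrightarrow> v \<in> V \<Longrightarrow> r x y z v = G y z * r x z z v - G x z * r y z z v"
    and trace: "r a z z a + r b z z b = 2 * k"
    and p_def: "\<And>x v. p x v = r x z z v - k * (G x v - G x z * G v z)"
    and V4: "x \<in> V" "y \<in> V" "u \<in> V" "v \<in> V"
  shows "r x y u v = r a b b a * (G y u * G x v - G x u * G y v)
    + (r a b b a - k) * (G x z * G u z * G y v - G y z * G u z * G x v
        + G x u * G y z * G v z - G y u * G x z * G v z)
    + G y u * p x v - G x u * p y v + p y u * G x v - p x u * G y v"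
proof -
  have abz: "a \<in> V" "b \<in> V" "z \<in> V" using B(1) by (auto simp: orthonormal_def)
  have G: "G a a = 1" "G b b = 1" "G z z = 1" "G a b = 0" "G b a = 0" "G a z = 0" "G b z = 0"
      "G z a = 0" "G z b = 0"
    using B unfolding orthonormal_def by auto
  define K where "K = r a b b a"
  have p_sym: "p x v = p v x" if "x \<in> V" "v \<in> V" for x v
  proof -
    have "r x z z v = r v z z x"
      using pair[OF that(1) abz(3) abz(3) that(2)] skew12[OF abz(3) that(2) that(1) abz(3)]
        skew34[OF that(2) abz(3) that(1) abz(3)] by simp
    then show ?thesis using sym[OF that] by (simp add: p_def)
  qed
  have r0: "r x y z z = 0" if "x \<in> V" "y \<in> V" for x y
    using skew34[OF that abz(3) abz(3)] by simp
  have pz: "p x z = 0" if "x \<in> V" for x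
    using r0[OF that abz(3)] G that by (simp add: p_def)
  have p_lin: "p (s *\<^sub>R x + t *\<^sub>R x') v = s * p x v + t * p x' v"
    if "x \<in> V" "x' \<in> V" "v \<in> V" for x x' v s t
    using that abz by (simp add: p_def lin1 lin_left algebra_simps)
  define S where "S x y u v = r x y u v - (K * (G y u * G x v - G x u * G y v)
    + (K - k) * (G x z * G u z * G y v - G y z * G u z * G x v
        + G x u * G y z * G v z - G y u * G x z * G v z)
    + G y u * p x v - G x u * p y v + p y u * G x v - p x u * G y v)" for x y u v
  have S_lin: "S (s *\<^sub>R x + t *\<^sub>R x') y u v = s * S x y u v + t * S x' y u v"
    if "x \<in> V" "x' \<in> V" "y \<in> V" "u \<in> V" "v \<in> V" for x x' y u v s t
    using that abz by (simp add: S_def lin1 lin_left p_lin algebra_simps)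
  have S12: "S x y u v = - S y x u v" if "x \<in> V" "y \<in> V" "u \<in> V" "v \<in> V" for x y u v
    unfolding S_def skew12[OF that] by (simp add: algebra_simps)
  have S34: "S x y u v = - S x y v u" if "x \<in> V" "y \<in> V" "u \<in> V" "v \<in> V" for x y u v
    unfolding S_def skew34[OF that] by (simp add: algebra_simps)
  have S_pair: "S x y u v = S u v x y" if "x \<in> V" "y \<in> V" "u \<in> V" "v \<in> V" for x y u v
    unfolding S_def pair[OF that]
    using sym[of x u] sym[of x v] sym[of y u] sym[of y v]
      p_sym[of x u] p_sym[of x v] p_sym[of y u] p_sym[of y v] that
    by (simp add: algebra_simps)
  have S3: "S x y z v = 0" if "x \<in> V" "y \<in> V" "v \<in> V" for x y v
    unfolding S_def rz[OF that]
    using pz that G(3) sym[of z v] abz by (simp add: p_def algebra_simps)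
  have S1: "S z y u v = 0" if "y \<in> V" "u \<in> V" "v \<in> V" for y u v
    using S_pair[OF abz(3) that] S3[OF that(2,3,1)] by simp
  have "S a b b a = 0"
    using trace G by (simp add: S_def K_def p_def algebra_simps)
  then have Sab: "S a b a b = 0" using S34[of a b a b] abz by simp
  have S3_lin: "S a b (s *\<^sub>R x + t *\<^sub>R x') y = s * S a b x y + t * S a b x' y"
    if "x \<in> V" "x' \<in> V" "y \<in> V" for x x' y s t
    using S_pair[OF abz(1,2) lincomb_closed[OF that(1,2)] that(3), of s t]
      S_pair[OF abz(1,2) that(1,3)] S_pair[OF abz(1,2) that(2,3)] S_lin[OF that abz(1,2)]
    by simp
  have "S a b u v = 0"
    by (rule alternating_form_zero[OF B, of "S a b", OF S3_lin S34[OF abz(1,2)] S3[OF abz(1,2)] Sab V4(3,4)])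
  then have "S x y u v = 0"
    by (intro alternating_form_zero[OF B, of "\<lambda>x y. S x y u v", OF S_lin[OF _ _ _ V4(3,4)]
        S12[OF _ _ V4(3,4)] S1[OF _ V4(3,4)] _ V4(1,2)])
  then show ?thesis by (simp add: S_def K_def)
qed

end

text \<open>Milnor's octahedron argument: the four cyclic identities for \<open>x y u v\<close>, \<open>y u v x\<close>, \<open>u v x y\<close>,
  \<open>v x y u\<close> are four faces of an octahedron with values of \<open>r\<close> as vertices; up to the skew symmetries, a
  signed sum of them leaves twice the difference of the two sides.\<close>

lemma curvature_pair_symmetry:
  fixes r :: "'a \<Rightarrow> 'a \<Rightarrow> 'a \<Rightarrow> 'a \<Rightarrow> real"
  assumes skew12: "\<And>x y u v. x \<in> V \<Longrightarrow> y \<in> V \<Longrightarrow> u \<in> V \<Longrightarrow> v \<in> V \<Longrightarrow> r x y u v = - r y x u v"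
    and skew34: "\<And>x y u v. x \<in> V \<Longrightarrow> y \<in> V \<Longrightarrow> u \<in> V \<Longrightarrow> v \<in> V \<Longrightarrow> r x y u v = - r x y v u"
    and cyclic: "\<And>x y u v. x \<in> V \<Longrightarrow> y \<in> V \<Longrightarrow> u \<in> V \<Longrightarrow> v \<in> V \<Longrightarrow>
      r x y u v + r y u x v + r u x y v = 0"
    and V: "x \<in> V" "y \<in> V" "u \<in> V" "v \<in> V"
  shows "r x y u v = r u v x y"
  using cyclic[OF V(1,2,3,4)] cyclic[OF V(2,3,4,1)] cyclic[OF V(3,4,1,2)] cyclic[OF V(4,1,2,3)]
    skew12[OF V(1,2,3,4)] skew12[OF V(2,3,1,4)] skew12[OF V(3,1,2,4)]
    skew34[OF V(1,2,3,4)] skew34[OF V(2,3,1,4)] skew34[OF V(3,1,2,4)]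
    skew12[OF V(2,3,4,1)] skew12[OF V(3,4,2,1)] skew12[OF V(4,2,3,1)]
    skew34[OF V(2,3,4,1)] skew34[OF V(3,4,2,1)] skew34[OF V(4,2,3,1)]
    skew12[OF V(3,4,1,2)] skew12[OF V(4,1,3,2)] skew12[OF V(1,3,4,2)]
    skew34[OF V(3,4,1,2)] skew34[OF V(4,1,3,2)] skew34[OF V(1,3,4,2)]
    skew12[OF V(4,1,2,3)] skew12[OF V(1,2,4,3)] skew12[OF V(2,4,1,3)]
    skew34[OF V(4,1,2,3)] skew34[OF V(1,2,4,3)] skew34[OF V(2,4,1,3)]
  by linarith

section \<open>The curvature at a point\<close>

context riemannian_manifold
begin

lemma inner_product_tangent: "inner_product_on (tangent_space A p) (g p)"
  by unfold_locales
    (use subspace_tangent_space metric_sym metric_lin_right metric_pos in auto)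

abbreviation Rm :: "'m \<Rightarrow> 'm tvec \<Rightarrow> 'm tvec \<Rightarrow> 'm tvec \<Rightarrow> 'm tvec"
  where "Rm \<equiv> curvature_at A D"

lemma curvature_at_tangent:
  "x \<in> tangent_space A p \<Longrightarrow> y \<in> tangent_space A p \<Longrightarrow> u \<in> tangent_space A p \<Longrightarrow>
    Rm p x y u \<in> tangent_space A p"
  unfolding curvature_at_def
  by (rule vector_fieldsD(1)[OF vf_curvature[OF extend_tvec(1) extend_tvec(1) extend_tvec(1)]])

lemma curvature_at_symmetries:
  assumes "x \<in> tangent_space A p" "y \<in> tangent_space A p" "u \<in> tangent_space A p" "v \<in> tangent_space A p"
  shows "Rm p x y u = - Rm p y x u"
    and "Rm p x y u + Rm p y u x + Rm p u x y = 0"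
    and "g p (Rm p x y u) v = - g p (Rm p x y v) u"
proof -
  let ?X = "extend_tvec A p x" and ?Y = "extend_tvec A p y"
    and ?U = "extend_tvec A p u" and ?V = "extend_tvec A p v"
  note e = extend_tvec(1)[OF assms(1)] extend_tvec(1)[OF assms(2)]
    extend_tvec(1)[OF assms(3)] extend_tvec(1)[OF assms(4)]
  show "Rm p x y u = - Rm p y x u"
    using curvature_skew[OF e(1,2,3)] by (simp add: curvature_at_def)
  show "Rm p x y u + Rm p y u x + Rm p u x y = 0"
    using fun_cong[OF bianchi[OF e(1,2,3)], of p] by (simp add: curvature_at_def)
  show "g p (Rm p x y u) v = - g p (Rm p x y v) u"
    using curvature_metric_skew[OF e, of p] by (simp add: curvature_at_def extend_tvec(2) assms)
qed

lemma curvature_at_linear: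
  assumes "x \<in> tangent_space A p" "x' \<in> tangent_space A p" "y \<in> tangent_space A p" "u \<in> tangent_space A p"
  shows "Rm p (s *\<^sub>R x + t *\<^sub>R x') y u = s *\<^sub>R Rm p x y u + t *\<^sub>R Rm p x' y u"
    and "Rm p y (s *\<^sub>R x + t *\<^sub>R x') u = s *\<^sub>R Rm p y x u + t *\<^sub>R Rm p y x' u"
    and "Rm p y u (s *\<^sub>R x + t *\<^sub>R x') = s *\<^sub>R Rm p y u x + t *\<^sub>R Rm p y u x'"
proof -
  let ?X = "extend_tvec A p x" and ?X' = "extend_tvec A p x'" and ?Y = "extend_tvec A p y"
    and ?U = "extend_tvec A p u"
  let ?W = "(\<lambda>q. s) \<odot> ?X + (\<lambda>q. t) \<odot> ?X'"
  note e = extend_tvec(1)[OF assms(1)] extend_tvec(1)[OF assms(2)]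
    extend_tvec(1)[OF assms(3)] extend_tvec(1)[OF assms(4)]
  note ep = extend_tvec(2)[OF assms(1)] extend_tvec(2)[OF assms(2)]
    extend_tvec(2)[OF assms(3)] extend_tvec(2)[OF assms(4)]
  have W: "?W \<in> vector_fields A" by (intro vf_add vf_scale smooth_fun_const e)
  have Wp: "?W p = s *\<^sub>R x + t *\<^sub>R x'" by (simp add: fscale_apply ep)
  note sc = vf_scale[OF smooth_fun_const e(1), of s] vf_scale[OF smooth_fun_const e(2), of t]
  show "Rm p (s *\<^sub>R x + t *\<^sub>R x') y u = s *\<^sub>R Rm p x y u + t *\<^sub>R Rm p x' y u"
  proof -
    have "Rm p (s *\<^sub>R x + t *\<^sub>R x') y u = curvature D ?W ?Y ?U p"
      using curvature_at_eq[OF W e(3,4), of p] by (simp only: Wp ep)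
    also have "\<dots> = s *\<^sub>R curvature D ?X ?Y ?U p + t *\<^sub>R curvature D ?X' ?Y ?U p"
      by (simp add: curvature_add1[OF sc e(3,4)] curvature_scale1[OF smooth_fun_const] e fscale_apply)
    finally show ?thesis by (simp add: curvature_at_eq e ep)
  qed
  show "Rm p y (s *\<^sub>R x + t *\<^sub>R x') u = s *\<^sub>R Rm p y x u + t *\<^sub>R Rm p y x' u"
  proof -
    have "Rm p y (s *\<^sub>R x + t *\<^sub>R x') u = curvature D ?Y ?W ?U p"
      using curvature_at_eq[OF e(3) W e(4), of p] by (simp only: Wp ep)
    also have "\<dots> = s *\<^sub>R curvature D ?Y ?X ?U p + t *\<^sub>R curvature D ?Y ?X' ?U p"
      by (simp add: curvature_add2[OF e(3) sc e(4)] curvature_scale2[OF smooth_fun_const] e fscale_apply)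
    finally show ?thesis by (simp add: curvature_at_eq e ep)
  qed
  show "Rm p y u (s *\<^sub>R x + t *\<^sub>R x') = s *\<^sub>R Rm p y u x + t *\<^sub>R Rm p y u x'"
  proof -
    have "Rm p y u (s *\<^sub>R x + t *\<^sub>R x') = curvature D ?Y ?U ?W p"
      using curvature_at_eq[OF e(3,4) W, of p] by (simp only: Wp ep)
    also have "\<dots> = s *\<^sub>R curvature D ?Y ?U ?X p + t *\<^sub>R curvature D ?Y ?U ?X' p"
      by (simp add: curvature_add3[OF e(3,4) sc] curvature_scale3[OF smooth_fun_const] e fscale_apply)
    finally show ?thesis by (simp add: curvature_at_eq e ep)
  qed
qed

text \<open>The Ricci form represents a unique operator because the metric is nondegenerate; its trace and the
  trace defining the Ricci form are both computed in the same orthonormal basis.\<close>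

lemma scalar_curvature_orthonormal:
  assumes B: "inner_product_on.orthonormal (tangent_space A p) (g p) B" "span B = tangent_space A p"
  shows "scalar_curvature A g D p = (\<Sum>c\<in>B. \<Sum>b\<in>B. g p (Rm p b c c) b)"
proof -
  interpret inner_product_on "tangent_space A p" "g p" by (rule inner_product_tangent)
  let ?T = "tangent_space A p"
  have BV: "B \<subseteq> ?T" "finite B" using B(1) by (auto simp: orthonormal_def)
  have ric: "ricci_at A D p v w = (\<Sum>b\<in>B. g p (Rm p b v w) b)" if "v \<in> ?T" "w \<in> ?T" for v w
    unfolding ricci_at_def
    by (rule trace_orthonormal[OF B])
      (use that in \<open>auto simp: linear_on_space_def curvature_at_linear(1) curvature_at_tangent\<close>)
  have ric_lin: "ricci_at A D p (s *\<^sub>R x + t *\<^sub>R x') w = s * ricci_at A D p x w + t * ricci_at A D p x' w"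
      "ricci_at A D p w (s *\<^sub>R x + t *\<^sub>R x') = s * ricci_at A D p w x + t * ricci_at A D p w x'"
    if "x \<in> ?T" "x' \<in> ?T" "w \<in> ?T" for x x' w s t
  proof -
    have "g p (Rm p b (s *\<^sub>R x + t *\<^sub>R x') w) b = s * g p (Rm p b x w) b + t * g p (Rm p b x' w) b"
        "g p (Rm p b w (s *\<^sub>R x + t *\<^sub>R x')) b = s * g p (Rm p b w x) b + t * g p (Rm p b w x') b"
      if "b \<in> B" for b
      using that \<open>x \<in> ?T\<close> \<open>x' \<in> ?T\<close> \<open>w \<in> ?T\<close> BV
      by (simp_all add: curvature_at_linear(2,3) lin_left curvature_at_tangent subset_iff)
    then show "ricci_at A D p (s *\<^sub>R x + t *\<^sub>R x') w = s * ricci_at A D p x w + t * ricci_at A D p x' w"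
      "ricci_at A D p w (s *\<^sub>R x + t *\<^sub>R x') = s * ricci_at A D p w x + t * ricci_at A D p w x'"
      using that by (simp_all add: ric lincomb_closed sum.distrib sum_distrib_left)
  qed
  define Q where "Q v = (\<Sum>c\<in>B. ricci_at A D p v c *\<^sub>R c)" for v
  have QT: "Q v \<in> ?T" for v
    unfolding Q_def using BV by (intro subspace_sum[OF V] subspace_scale[OF V]) auto
  have Qg: "g p (Q v) w = ricci_at A D p v w" if v: "v \<in> ?T" and w: "w \<in> ?T" for v w
  proof -
    have sum_lin: "ricci_at A D p v (\<Sum>c\<in>I. f c *\<^sub>R c) = (\<Sum>c\<in>I. f c * ricci_at A D p v c)"
      if "I \<subseteq> B" for I f
      using finite_subset[OF that BV(2)] that
    proof (induction I rule: finite_induct)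
      case empty
      have "ricci_at A D p v 0 = 0" using ric_lin(2)[OF v v v, of 0 0] by simp
      then show ?case by (simp only: sum.empty)
    next
      case (insert c I)
      have c: "c \<in> ?T" and I: "I \<subseteq> B" using insert.prems BV by auto
      have s: "(\<Sum>c\<in>I. f c *\<^sub>R c) \<in> ?T"
        using BV I by (intro subspace_sum[OF V] subspace_scale[OF V]) auto
      have "ricci_at A D p v (f c *\<^sub>R c + 1 *\<^sub>R (\<Sum>c\<in>I. f c *\<^sub>R c))
          = f c * ricci_at A D p v c + 1 * (\<Sum>c\<in>I. f c * ricci_at A D p v c)"
        by (simp only: ric_lin(2)[OF c s v] insert.IH[OF I])
      then show ?case by (simp only: sum.insert[OF insert.hyps] scaleR_one mult_1)
    qed
    have "g p (Q v) w = (\<Sum>c\<in>B. g p (ricci_at A D p v c *\<^sub>R c) w)"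
      unfolding Q_def using BV w by (intro sum_left subspace_scale[OF V]) auto
    also have "\<dots> = (\<Sum>c\<in>B. g p w c * ricci_at A D p v c)"
      using BV w by (intro sum.cong) (auto simp: scale_left metric_sym[of w])
    also have "\<dots> = ricci_at A D p v w"
      using sum_lin[of B "g p w"] orthonormal_expand[OF B w] by simp
    finally show ?thesis .
  qed
  have "ricci_operator A g D p v = Q v" if "v \<in> ?T" for v
    unfolding ricci_operator_def
  proof (rule the_equality)
    show "Q v \<in> ?T \<and> (\<forall>w\<in>?T. g p (Q v) w = ricci_at A D p v w)" using QT Qg that by blast
    fix q assume "q \<in> ?T \<and> (\<forall>w\<in>?T. g p q w = ricci_at A D p v w)"
    then show "q = Q v" using QT Qg[OF that] by (intro nondegenerate) auto
  qed
  note op = this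
  have "linear_on_space ?T (ricci_operator A g D p)"
    unfolding linear_on_space_def
  proof (intro ballI allI)
    fix x y :: "'m tvec" and s t :: real assume "x \<in> ?T" "y \<in> ?T"
    then show "ricci_operator A g D p (s *\<^sub>R x + t *\<^sub>R y)
        = s *\<^sub>R ricci_operator A g D p x + t *\<^sub>R ricci_operator A g D p y"
      by (intro nondegenerate) (auto simp: op lincomb_closed QT Qg lin_left ric_lin)
  qed
  then have "scalar_curvature A g D p = (\<Sum>c\<in>B. g p (ricci_operator A g D p c) c)"
    unfolding scalar_curvature_def by (rule trace_orthonormal[OF B]) (auto simp: op QT)
  also have "\<dots> = (\<Sum>c\<in>B. \<Sum>b\<in>B. g p (Rm p b c c) b)"
    using BV by (intro sum.cong) (auto simp: op Qg ric)
  finally show ?thesis .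
qed

end

section \<open>Almost contact metric structures with closed contact form\<close>

locale contact_closed_form = riemannian_manifold A g D
  for A :: "('m::{t2_space,second_countable_topology}, 'e::euclidean_space) chart set"
    and g :: "'m form2" and D :: "'m vfield \<Rightarrow> 'm vfield \<Rightarrow> 'm vfield" +
  fixes \<phi> :: "'m endo" and \<xi> :: "'m vfield" and \<eta> :: "'m form1"
  assumes contact: "almost_contact_metric A \<phi> \<xi> \<eta> g"
    and closed_form: "X \<in> vector_fields A \<Longrightarrow> Y \<in> vector_fields A \<Longrightarrow> ext_deriv1 \<eta> X Y = (\<lambda>p. 0)"
begin

lemma xi_field: "\<xi> \<in> vector_fields A"
  using contact unfolding almost_contact_metric_def by blast

lemma xi_tangent: "\<xi> p \<in> tangent_space A p"
  using xi_field vector_fieldsD(1) by blast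

lemma eta_xi: "\<eta> p (\<xi> p) = 1"
  using contact unfolding almost_contact_metric_def by blast

lemma xi_nonzero: "\<xi> p \<noteq> 0"
proof -
  have "linear_on_space (tangent_space A p) (\<eta> p)"
    using contact unfolding almost_contact_metric_def one_form_def by blast
  then have "\<eta> p (0 *\<^sub>R \<xi> p + 0 *\<^sub>R \<xi> p) = 0 *\<^sub>R \<eta> p (\<xi> p) + 0 *\<^sub>R \<eta> p (\<xi> p)"
    using xi_tangent unfolding linear_on_space_def by blast
  then have "\<eta> p 0 = 0" by simp
  then show ?thesis using eta_xi[of p] by auto
qed

lemma phi_tangent: "u \<in> tangent_space A p \<Longrightarrow> \<phi> p u \<in> tangent_space A p"
  using contact unfolding almost_contact_metric_def endomorphism_field_def by blast

lemma phi_field: "X \<in> vector_fields A \<Longrightarrow> endo_app \<phi> X \<in> vector_fields A"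
  using contact unfolding almost_contact_metric_def endomorphism_field_def by blast

lemma phi_lin:
  assumes "u \<in> tangent_space A p" "v \<in> tangent_space A p"
  shows "\<phi> p (a *\<^sub>R u + b *\<^sub>R v) = a *\<^sub>R \<phi> p u + b *\<^sub>R \<phi> p v"
proof -
  have "linear_on_space (tangent_space A p) (\<phi> p)"
    using contact unfolding almost_contact_metric_def endomorphism_field_def by blast
  then show ?thesis using assms unfolding linear_on_space_def by blast
qed

lemma phi_scale: "u \<in> tangent_space A p \<Longrightarrow> \<phi> p (a *\<^sub>R u) = a *\<^sub>R \<phi> p u"
  using phi_lin[of u p u a 0] by simp

lemma phi_zero: "\<phi> p 0 = 0"
  using phi_scale[OF xi_tangent, of p 0] by simp

lemma phi_diff: "u \<in> tangent_space A p \<Longrightarrow> v \<in> tangent_space A p \<Longrightarrow> \<phi> p (u - v) = \<phi> p u - \<phi> p v"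
  using phi_lin[of u p v 1 "-1"] by simp

lemma phi_phi: "u \<in> tangent_space A p \<Longrightarrow> \<phi> p (\<phi> p u) = - u + \<eta> p u *\<^sub>R \<xi> p"
  using contact unfolding almost_contact_metric_def by blast

lemma phi_metric:
  "u \<in> tangent_space A p \<Longrightarrow> v \<in> tangent_space A p \<Longrightarrow>
    g p (\<phi> p u) (\<phi> p v) = g p u v - \<eta> p u * \<eta> p v"
  using contact unfolding almost_contact_metric_def by blast

text \<open>Evaluate \<open>\<phi>\<^sup>3 \<xi>\<close> in two ways: \<open>\<phi>\<^sup>2 \<xi> = 0\<close> makes \<open>\<phi> \<xi>\<close> a multiple of \<open>\<xi>\<close>, and the
  square of the factor has to vanish as well.\<close>

lemma phi_xi: "\<phi> p (\<xi> p) = 0"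
proof -
  have "\<phi> p (\<phi> p (\<xi> p)) = 0" using phi_phi[OF xi_tangent] eta_xi by simp
  moreover have "\<phi> p (\<phi> p (\<phi> p (\<xi> p))) = - \<phi> p (\<xi> p) + \<eta> p (\<phi> p (\<xi> p)) *\<^sub>R \<xi> p"
    by (rule phi_phi[OF phi_tangent[OF xi_tangent]])
  ultimately have *: "\<phi> p (\<xi> p) = \<eta> p (\<phi> p (\<xi> p)) *\<^sub>R \<xi> p" using phi_zero by simp
  have "\<phi> p (\<phi> p (\<xi> p)) = \<eta> p (\<phi> p (\<xi> p)) *\<^sub>R \<phi> p (\<xi> p)"
    by (subst (1) *) (rule phi_scale[OF xi_tangent])
  then have "\<eta> p (\<phi> p (\<xi> p)) = 0 \<or> \<phi> p (\<xi> p) = 0" using \<open>\<phi> p (\<phi> p (\<xi> p)) = 0\<close> by simp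
  then show ?thesis
  proof
    assume "\<eta> p (\<phi> p (\<xi> p)) = 0"
    then show ?thesis using * by (metis scaleR_zero_left)
  qed
qed

lemma eta_metric:
  assumes "u \<in> tangent_space A p"
  shows "\<eta> p u = g p u (\<xi> p)"
proof -
  interpret inner_product_on "tangent_space A p" "g p" by (rule inner_product_tangent)
  have "g p (\<phi> p u) 0 = 0"
    using zero_left[OF phi_tangent[OF assms]] sym[OF phi_tangent[OF assms] subspace_0[OF V]] by simp
  then show ?thesis using phi_metric[OF assms xi_tangent] by (simp add: phi_xi eta_xi)
qed

lemma eta_phi:
  assumes "u \<in> tangent_space A p"
  shows "\<eta> p (\<phi> p u) = 0"
proof -
  have "\<phi> p (\<phi> p (\<phi> p u)) = - \<phi> p u + \<eta> p (\<phi> p u) *\<^sub>R \<xi> p"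
    by (rule phi_phi[OF phi_tangent[OF assms]])
  moreover have "\<phi> p (\<phi> p (\<phi> p u)) = - \<phi> p u"
    using phi_lin[OF assms xi_tangent, of "-1" "\<eta> p u"] by (simp add: phi_phi[OF assms] phi_xi)
  ultimately show ?thesis using xi_nonzero[of p] by simp
qed

lemma eta_smooth: "X \<in> vector_fields A \<Longrightarrow> smooth_fun A (form1_app \<eta> X)"
  using contact unfolding almost_contact_metric_def one_form_def by blast

text \<open>Since \<open>\<eta>\<close> is closed and \<open>\<eta>(\<xi>)\<close> is constant, \<open>\<eta>\<close> is invariant under the flow of \<open>\<xi>\<close>.\<close>

lemma eta_bracket_xi:
  assumes "X \<in> vector_fields A"
  shows "form1_app \<eta> (lie_bracket \<xi> X) = deriv_along \<xi> (form1_app \<eta> X)"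
proof
  fix p
  have "deriv_along X (form1_app \<eta> \<xi>) p = 0"
    using tangent_const[OF vector_fieldsD(1)[OF assms]] by (simp add: deriv_along_def form1_app_def eta_xi)
  then show "form1_app \<eta> (lie_bracket \<xi> X) p = deriv_along \<xi> (form1_app \<eta> X) p"
    using fun_cong[OF closed_form[OF xi_field assms], of p] by (simp add: ext_deriv1_def)
qed

abbreviation h :: "'m vfield \<Rightarrow> 'm vfield"
  where "h \<equiv> h_tensor \<phi> \<xi>"

lemma h_apply:
  "h X p = (1/2) *\<^sub>R (lie_bracket \<xi> (endo_app \<phi> X) p - \<phi> p (lie_bracket \<xi> X p))"
  by (simp add: h_tensor_def lie_deriv_endo_def scaleR_fun_apply endo_app_def)

lemma h_field: "X \<in> vector_fields A \<Longrightarrow> h X \<in> vector_fields A"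
  unfolding h_tensor_def lie_deriv_endo_def
  by (intro vf_scaleR vf_diff vf_bracket phi_field xi_field)

lemma h_xi: "h \<xi> p = 0"
proof -
  have "endo_app \<phi> \<xi> = 0" by (simp add: endo_app_def fun_eq_iff phi_xi)
  moreover have "lie_bracket \<xi> 0 p = 0"
    using tangent_const[OF xi_tangent] by (simp add: lie_bracket_def deriv_along_def fun_eq_iff)
  moreover have "lie_bracket \<xi> \<xi> p = 0" by (simp add: lie_bracket_def fun_eq_iff)
  ultimately show ?thesis by (simp only: h_apply phi_zero) simp
qed

lemma eta_h:
  assumes X: "X \<in> vector_fields A"
  shows "\<eta> p (h X p) = 0"
proof -
  interpret inner_product_on "tangent_space A p" "g p" by (rule inner_product_tangent)
  note T = vector_fieldsD(1)[OF vf_bracket[OF xi_field phi_field[OF X]]]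
    phi_tangent[OF vector_fieldsD(1)[OF vf_bracket[OF xi_field X]]]
  have "form1_app \<eta> (endo_app \<phi> X) = (\<lambda>q. 0)"
    using eta_phi vector_fieldsD(1)[OF X] by (simp add: form1_app_def endo_app_def)
  then have "\<eta> p (lie_bracket \<xi> (endo_app \<phi> X) p) = 0"
    using fun_cong[OF eta_bracket_xi[OF phi_field[OF X]], of p] tangent_const[OF xi_tangent]
    by (simp add: form1_app_def deriv_along_def)
  moreover have "\<eta> p (\<phi> p (lie_bracket \<xi> X p)) = 0"
    by (rule eta_phi[OF vector_fieldsD(1)[OF vf_bracket[OF xi_field X]]])
  ultimately show ?thesis
    using T xi_tangent eta_metric[OF vector_fieldsD(1)[OF h_field[OF X]]]
    by (simp add: h_apply eta_metric scale_left diff_left subspace_diff[OF V])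
qed

text \<open>Apply the Lie derivative along \<open>\<xi>\<close> to \<open>\<phi>\<^sup>2 = -1 + \<eta>\<otimes>\<xi>\<close>. The right-hand side is invariant,
  because \<open>\<eta>\<close> is; so \<open>h\<phi> + \<phi>h = 0\<close>.\<close>

lemma h_phi:
  assumes X: "X \<in> vector_fields A"
  shows "h (endo_app \<phi> X) p = - \<phi> p (h X p)"
proof -
  let ?Y = "endo_app \<phi> X"
  note b = vector_fieldsD(1)[OF vf_bracket[OF xi_field X]]
    vector_fieldsD(1)[OF vf_bracket[OF xi_field phi_field[OF X]]]
  have phiY: "endo_app \<phi> ?Y = (\<lambda>q. -1) \<odot> X + form1_app \<eta> X \<odot> \<xi>"
  proof
    fix q
    show "endo_app \<phi> ?Y q = ((\<lambda>q. -1) \<odot> X + form1_app \<eta> X \<odot> \<xi>) q"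
      using phi_phi[OF vector_fieldsD(1)[OF X], of q] by (simp add: endo_app_def fscale_apply form1_app_def)
  qed
  have "lie_bracket \<xi> (endo_app \<phi> ?Y)
      = lie_bracket \<xi> ((\<lambda>q. -1) \<odot> X) + lie_bracket \<xi> (form1_app \<eta> X \<odot> \<xi>)"
    unfolding phiY by (intro lie_bracket_add_right vf_scale smooth_fun_const eta_smooth X xi_field)
  then have "lie_bracket \<xi> (endo_app \<phi> ?Y) p
      = lie_bracket \<xi> ((\<lambda>q. -1) \<odot> X) p + lie_bracket \<xi> (form1_app \<eta> X \<odot> \<xi>) p"
    by simp
  also have "\<dots> = - lie_bracket \<xi> X p + \<eta> p (lie_bracket \<xi> X p) *\<^sub>R \<xi> p"
    using fun_cong[OF eta_bracket_xi[OF X], of p] tangent_const[OF xi_tangent]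
    unfolding lie_bracket_scale_right[OF eta_smooth[OF X] xi_field xi_field]
      lie_bracket_scale_right[OF smooth_fun_const X xi_field]
    by (simp add: fscale_apply form1_app_def deriv_along_def fun_eq_iff scaleR_fun_apply
        lie_bracket_def[of \<xi> \<xi>])
  finally have 1: "lie_bracket \<xi> (endo_app \<phi> ?Y) p
      = - lie_bracket \<xi> X p + \<eta> p (lie_bracket \<xi> X p) *\<^sub>R \<xi> p" .
  have "\<phi> p (h X p) = (1/2) *\<^sub>R (\<phi> p (lie_bracket \<xi> ?Y p) - \<phi> p (\<phi> p (lie_bracket \<xi> X p)))"
    using b by (simp add: h_apply phi_scale phi_diff phi_tangent subspace_diff[OF subspace_tangent_space])
  also have "\<dots> = (1/2) *\<^sub>R (\<phi> p (lie_bracket \<xi> ?Y p) + lie_bracket \<xi> X p - \<eta> p (lie_bracket \<xi> X p) *\<^sub>R \<xi> p)"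
    by (simp add: phi_phi[OF b(1)] algebra_simps)
  finally have 2: "\<phi> p (h X p) = (1/2) *\<^sub>R (\<phi> p (lie_bracket \<xi> ?Y p) + lie_bracket \<xi> X p
      - \<eta> p (lie_bracket \<xi> X p) *\<^sub>R \<xi> p)" .
  show ?thesis
    unfolding h_apply[of ?Y] 1 2 by (simp add: algebra_simps)
qed

text \<open>Both \<open>h\<close> and \<open>\<phi>h\<close> anticommute with \<open>\<phi>\<close> and take values orthogonal to \<open>\<xi>\<close>. For such an operator
  \<open>L\<close>, \<open>g (L \<phi>X) (\<phi>X) = - g (\<phi> L X) (\<phi>X) = - g (L X) X\<close>.\<close>

lemma trace_h:
  assumes X: "X \<in> vector_fields A"
  shows "g p (h X p) (X p) + g p (h (endo_app \<phi> X) p) (endo_app \<phi> X p) = 0"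
    and "g p (\<phi> p (h X p)) (X p) + g p (\<phi> p (h (endo_app \<phi> X) p)) (endo_app \<phi> X p) = 0"
proof -
  interpret inner_product_on "tangent_space A p" "g p" by (rule inner_product_tangent)
  let ?Y = "endo_app \<phi> X"
  have Y: "?Y p = \<phi> p (X p)" by (simp add: endo_app_def)
  note XT = vector_fieldsD(1)[OF X, of p] and hT = vector_fieldsD(1)[OF h_field[OF X], of p]
    and hYT = vector_fieldsD(1)[OF h_field[OF phi_field[OF X]], of p]
  have minus: "g p (- u) v = - g p u v" if "u \<in> tangent_space A p" "v \<in> tangent_space A p" for u v
    using scale_left[OF that, of "-1"] by simp
  show "g p (h X p) (X p) + g p (h ?Y p) (?Y p) = 0"
    using phi_metric[OF hT XT] by (simp add: h_phi X Y minus phi_tangent hT XT eta_h)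
  show "g p (\<phi> p (h X p)) (X p) + g p (\<phi> p (h ?Y p)) (?Y p) = 0"
    using phi_metric[OF hYT XT] minus[OF phi_tangent[OF hT] XT]
    by (simp add: Y eta_h[OF phi_field[OF X]]) (simp add: h_phi X)
qed

text \<open>Normalise the part orthogonal to \<open>\<xi>\<close> of a vector outside the line of \<open>\<xi>\<close>. Its image under \<open>\<phi>\<close>
  is orthogonal to it because \<open>g e (\<phi> e) = g (\<phi> e) (\<phi>\<^sup>2 e) = - g (\<phi> e) e\<close>.\<close>

lemma contact_frame:
  assumes "DIM('e) = 3"
  obtains e where "e \<in> tangent_space A p"
    "inner_product_on.orthonormal (tangent_space A p) (g p) {e, \<phi> p e, \<xi> p}"
    "span {e, \<phi> p e, \<xi> p} = tangent_space A p"
    "e \<noteq> \<phi> p e" "e \<noteq> \<xi> p" "\<phi> p e \<noteq> \<xi> p"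
proof -
  interpret inner_product_on "tangent_space A p" "g p" by (rule inner_product_tangent)
  obtain S where S: "finite S" "independent S" "span S = tangent_space A p" "card S = DIM('e)"
    by (rule tangent_space_basis)
  have "\<not> S \<subseteq> span {\<xi> p}"
  proof
    assume "S \<subseteq> span {\<xi> p}"
    then have "card S \<le> card {\<xi> p}" using independent_span_bound[of "{\<xi> p}" S] S by simp
    then show False using S(4) assms by simp
  qed
  then obtain v where v: "v \<in> S" "v \<notin> span {\<xi> p}" by auto
  have vT: "v \<in> tangent_space A p" using v(1) S(3) span_base by blast
  have gxi: "g p (\<xi> p) (\<xi> p) = 1" using eta_metric[OF xi_tangent] eta_xi by simp
  define w where "w = v - \<eta> p v *\<^sub>R \<xi> p"
  have wT: "w \<in> tangent_space A p"
    unfolding w_def using vT xi_tangent by (intro subspace_diff[OF V] subspace_scale[OF V])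
  have w0: "w \<noteq> 0" using v(2) by (auto simp: w_def span_singleton)
  have wxi: "g p w (\<xi> p) = 0"
    using vT xi_tangent
    by (simp add: w_def diff_left scale_left subspace_scale[OF V] gxi eta_metric)
  define e where "e = (1 / sqrt (g p w w)) *\<^sub>R w"
  have eT: "e \<in> tangent_space A p" using wT by (simp add: e_def subspace_scale[OF V])
  have gw: "g p w w > 0" by (rule pos[OF wT w0])
  have "g p e e = (1 / sqrt (g p w w)) * (g p w e)" using wT eT by (simp add: e_def scale_left)
  also have "g p w e = (1 / sqrt (g p w w)) * g p w w"
    using sym[OF wT eT] wT by (simp add: e_def scale_left)
  finally have ee: "g p e e = 1" using gw by (simp add: field_simps)
  have exi: "g p e (\<xi> p) = 0" using wT xi_tangent wxi by (simp add: e_def scale_left)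
  have eta_e: "\<eta> p e = 0" using exi eta_metric[OF eT] by simp
  have fT: "\<phi> p e \<in> tangent_space A p" by (rule phi_tangent[OF eT])
  have ff: "g p (\<phi> p e) (\<phi> p e) = 1" using phi_metric[OF eT eT] ee eta_e by simp
  have fxi: "g p (\<phi> p e) (\<xi> p) = 0" using eta_phi[OF eT] eta_metric[OF fT] by simp
  have ef: "g p e (\<phi> p e) = 0"
  proof -
    have "g p (\<phi> p e) (\<phi> p (\<phi> p e)) = g p e (\<phi> p e)"
      using phi_metric[OF eT fT] eta_e by simp
    moreover have "\<phi> p (\<phi> p e) = - e" using phi_phi[OF eT] eta_e by simp
    moreover have "g p (- e) (\<phi> p e) = - g p e (\<phi> p e)" using scale_left[OF eT fT, of "-1"] by simp
    moreover have "g p (\<phi> p e) (- e) = g p (- e) (\<phi> p e)"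
      using sym[OF fT] eT subspace_neg[OF V] by blast
    ultimately show ?thesis by simp
  qed
  note o3 = orthonormal_three[OF eT fT xi_tangent ee ff gxi ef exi fxi]
  have "span {e, \<phi> p e, \<xi> p} = tangent_space A p"
    by (rule orthonormal_span[OF o3(1) S(1,3)]) (use o3(2-4) S(4) assms in simp)
  then show thesis using that eT o3 by blast
qed

end

section \<open>The curvature tensor in dimension three\<close>

theorem theorem3p28:
  fixes A :: "('m::{t2_space,second_countable_topology}, 'e::euclidean_space) chart set"
    and \<phi> :: "'m endo" and \<xi> :: "'m vfield" and \<eta> :: "'m form1" and g :: "'m form2"
    and D :: "'m vfield \<Rightarrow> 'm vfield \<Rightarrow> 'm vfield"
    and \<kappa> \<mu> \<nu> :: "'m \<Rightarrow> real"
  assumes "DIM('e) = 3"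
    and "kmn_space A \<phi> \<xi> \<eta> g D \<kappa> \<mu> \<nu>"
    and "(almost_cosymplectic A \<phi> \<xi> \<eta> g \<and> (\<forall>p. \<kappa> p < 0)) \<or>
         (almost_kenmotsu A \<phi> \<xi> \<eta> g \<and> (\<forall>p. \<kappa> p < -1))"
  shows "\<forall>X\<in>vector_fields A. \<forall>Y\<in>vector_fields A. \<forall>Z\<in>vector_fields A.
    curvature D X Y Z =
      (\<lambda>p. scalar_curvature A g D p / 2 - 2 * \<kappa> p) \<odot> R1 g X Y Z
      + (\<lambda>p. scalar_curvature A g D p / 2 - 3 * \<kappa> p) \<odot> R3 \<xi> \<eta> g X Y Z
      + \<mu> \<odot> R4 \<phi> \<xi> g X Y Z
      + \<nu> \<odot> R7 \<phi> \<xi> g X Y Z"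
proof (intro ballI)
  have acm: "almost_contact_metric A \<phi> \<xi> \<eta> g" and lc: "levi_civita A g D"
    using assms(2) unfolding kmn_space_def by auto
  have closed: "ext_deriv1 \<eta> X Y = (\<lambda>p. 0)" if "X \<in> vector_fields A" "Y \<in> vector_fields A" for X Y
    using assms(3) that unfolding almost_cosymplectic_def almost_kenmotsu_def by blast
  interpret contact_closed_form A g D \<phi> \<xi> \<eta>
    using acm lc closed by unfold_locales (auto simp: almost_contact_metric_def)
  fix X Y Z assume X: "X \<in> vector_fields A" and Y: "Y \<in> vector_fields A" and Z: "Z \<in> vector_fields A"
  have nullity: "curvature D U W \<xi> p = \<kappa> p *\<^sub>R (\<eta> p (W p) *\<^sub>R U p - \<eta> p (U p) *\<^sub>R W p)
      + \<mu> p *\<^sub>R (\<eta> p (W p) *\<^sub>R h U p - \<eta> p (U p) *\<^sub>R h W p)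
      + \<nu> p *\<^sub>R (\<eta> p (W p) *\<^sub>R \<phi> p (h U p) - \<eta> p (U p) *\<^sub>R \<phi> p (h W p))"
    if "U \<in> vector_fields A" "W \<in> vector_fields A" for U W p
  proof -
    have "curvature D U W \<xi> =
         \<kappa> \<odot> (form1_app \<eta> W \<odot> U - form1_app \<eta> U \<odot> W)
         + \<mu> \<odot> (form1_app \<eta> W \<odot> h U - form1_app \<eta> U \<odot> h W)
         + \<nu> \<odot> (form1_app \<eta> W \<odot> endo_app \<phi> (h U) - form1_app \<eta> U \<odot> endo_app \<phi> (h W))"
      using assms(2) that unfolding kmn_space_def Let_def by blast
    then show ?thesis by (simp add: fscale_apply form1_app_def endo_app_def)
  qed
  \<comment> \<open>Read backwards, this expresses \<open>\<mu> h + \<nu> \<phi>h\<close> by the Jacobi operator of \<open>\<xi>\<close>, which makes it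
    tensorial and symmetric.\<close>
  have jacobi_op: "Rm p (U p) (\<xi> p) (\<xi> p)
      = \<kappa> p *\<^sub>R (U p - \<eta> p (U p) *\<^sub>R \<xi> p) + (\<mu> p *\<^sub>R h U p + \<nu> p *\<^sub>R \<phi> p (h U p))"
    if "U \<in> vector_fields A" for U p
    using nullity[OF that xi_field, of p]
    by (simp add: curvature_at_eq[OF that xi_field xi_field] eta_xi h_xi phi_zero)
  have nullity_op: "Rm p (U p) (W p) (\<xi> p)
      = \<eta> p (W p) *\<^sub>R Rm p (U p) (\<xi> p) (\<xi> p) - \<eta> p (U p) *\<^sub>R Rm p (W p) (\<xi> p) (\<xi> p)"
    if "U \<in> vector_fields A" "W \<in> vector_fields A" for U W p
    using nullity[OF that, of p]
    by (simp add: curvature_at_eq[OF that xi_field] jacobi_op that algebra_simps)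
  show "curvature D X Y Z =
      (\<lambda>p. scalar_curvature A g D p / 2 - 2 * \<kappa> p) \<odot> R1 g X Y Z
      + (\<lambda>p. scalar_curvature A g D p / 2 - 3 * \<kappa> p) \<odot> R3 \<xi> \<eta> g X Y Z
      + \<mu> \<odot> R4 \<phi> \<xi> g X Y Z
      + \<nu> \<odot> R7 \<phi> \<xi> g X Y Z" (is "_ = ?rhs")
  proof
    fix p
    interpret inner_product_on "tangent_space A p" "g p" by (rule inner_product_tangent)
    let ?T = "tangent_space A p"
    obtain e where eT: "e \<in> ?T" and B: "orthonormal {e, \<phi> p e, \<xi> p}" "span {e, \<phi> p e, \<xi> p} = ?T"
        "e \<noteq> \<phi> p e" "e \<noteq> \<xi> p" "\<phi> p e \<noteq> \<xi> p"
      by (rule contact_frame[OF assms(1)])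
    define f where "f = \<phi> p e"
    note B = B[folded f_def]
    have abz: "e \<in> ?T" "f \<in> ?T" "\<xi> p \<in> ?T" using B(1) by (auto simp: orthonormal_def)
    have G: "g p e e = 1" "g p f f = 1" "g p e (\<xi> p) = 0" "g p f (\<xi> p) = 0"
      using B by (auto simp: orthonormal_def)
    define r where "r x y u v = g p (Rm p x y u) v" for x y u v
    have r12: "r x y u v = - r y x u v" if "x \<in> ?T" "y \<in> ?T" "u \<in> ?T" "v \<in> ?T" for x y u v
      using curvature_at_symmetries(1)[OF that(1-3) that(3)]
        scale_left[OF curvature_at_tangent[OF that(2,1,3)] that(4), of "-1"]
      by (simp add: r_def)
    have r34: "r x y u v = - r x y v u" if "x \<in> ?T" "y \<in> ?T" "u \<in> ?T" "v \<in> ?T" for x y u v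
      unfolding r_def by (rule curvature_at_symmetries(3)[OF that])
    have cyclic: "r x y u v + r y u x v + r u x y v = 0"
      if "x \<in> ?T" "y \<in> ?T" "u \<in> ?T" "v \<in> ?T" for x y u v
      unfolding r_def
      using curvature_at_symmetries(2)[OF that] that
      by (simp add: curvature_at_tangent subspace_add[OF V] zero_left flip: add_left)
    have pair: "r x y u v = r u v x y" if "x \<in> ?T" "y \<in> ?T" "u \<in> ?T" "v \<in> ?T" for x y u v
      by (rule curvature_pair_symmetry[of ?T r, OF r12 r34 cyclic that])
    have r_lin: "r (s *\<^sub>R x + t *\<^sub>R x') y u v = s * r x y u v + t * r x' y u v"
      if "x \<in> ?T" "x' \<in> ?T" "y \<in> ?T" "u \<in> ?T" "v \<in> ?T" for x x' y u v s t
      using that by (simp add: r_def curvature_at_linear(1) lin_left curvature_at_tangent)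
    have r_xi: "r x y (\<xi> p) v = g p y (\<xi> p) * r x (\<xi> p) (\<xi> p) v - g p x (\<xi> p) * r y (\<xi> p) (\<xi> p) v"
      if "x \<in> ?T" "y \<in> ?T" "v \<in> ?T" for x y v
    proof -
      have "Rm p x y (\<xi> p) = \<eta> p y *\<^sub>R Rm p x (\<xi> p) (\<xi> p) - \<eta> p x *\<^sub>R Rm p y (\<xi> p) (\<xi> p)"
        using nullity_op[OF extend_tvec(1)[OF that(1)] extend_tvec(1)[OF that(2)], of p]
        by (simp add: extend_tvec(2) that)
      then show ?thesis
        using that abz
        by (simp add: r_def diff_left scale_left curvature_at_tangent subspace_scale[OF V] eta_metric)
    qed
    have r_trace: "r e (\<xi> p) (\<xi> p) e + r f (\<xi> p) (\<xi> p) f = 2 * \<kappa> p"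
    proof -
      let ?E = "extend_tvec A p e"
      let ?F = "endo_app \<phi> ?E"
      note E = extend_tvec[OF eT]
      have F: "?F \<in> vector_fields A" "?F p = f" using phi_field E by (auto simp: endo_app_def f_def)
      have eta0: "\<eta> p e = 0" "\<eta> p f = 0" using G eta_metric abz by auto
      note hT = vector_fieldsD(1)[OF h_field[OF E(1)], of p] vector_fieldsD(1)[OF h_field[OF F(1)], of p]
      have "Rm p e (\<xi> p) (\<xi> p) = \<kappa> p *\<^sub>R e + (\<mu> p *\<^sub>R h ?E p + \<nu> p *\<^sub>R \<phi> p (h ?E p))"
        using jacobi_op[OF E(1), of p] by (simp add: E(2) eta0)
      moreover have "Rm p f (\<xi> p) (\<xi> p) = \<kappa> p *\<^sub>R f + (\<mu> p *\<^sub>R h ?F p + \<nu> p *\<^sub>R \<phi> p (h ?F p))"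
        using jacobi_op[OF F(1), of p] by (simp add: F(2) eta0)
      moreover have "g p (\<kappa> p *\<^sub>R u + (\<mu> p *\<^sub>R v + \<nu> p *\<^sub>R w)) u
          = \<kappa> p * g p u u + (\<mu> p * g p v u + \<nu> p * g p w u)"
        if "u \<in> ?T" "v \<in> ?T" "w \<in> ?T" for u v w
        using lin_left[OF that(1) lincomb_closed[OF that(2,3), of "\<mu> p" "\<nu> p"] that(1), of "\<kappa> p" 1]
          lin_left[OF that(2,3,1)] by simp
      ultimately have "r e (\<xi> p) (\<xi> p) e + r f (\<xi> p) (\<xi> p) f
          = 2 * \<kappa> p + \<mu> p * (g p (h ?E p) e + g p (h ?F p) f)
            + \<nu> p * (g p (\<phi> p (h ?E p)) e + g p (\<phi> p (h ?F p)) f)"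
        using hT abz by (simp add: r_def phi_tangent G algebra_simps)
      then show ?thesis using trace_h[OF E(1), of p] by (simp add: E(2) F(2))
    qed
    have "scalar_curvature A g D p
        = (\<Sum>c\<in>{e, f, \<xi> p}. \<Sum>b\<in>{e, f, \<xi> p}. r b c c b)"
      unfolding r_def by (rule scalar_curvature_orthonormal[OF B(1,2)])
    also have "\<dots> = 2 * r e f f e + 2 * (r e (\<xi> p) (\<xi> p) e + r f (\<xi> p) (\<xi> p) f)"
      using B(3-5) r12[of e e e e] r12[of f f f f] r12[of "\<xi> p" "\<xi> p" "\<xi> p" "\<xi> p"]
        pair[of e f f e] pair[of e "\<xi> p" "\<xi> p" e] pair[of f "\<xi> p" "\<xi> p" f] abz
      by simp
    finally have K: "r e f f e = scalar_curvature A g D p / 2 - 2 * \<kappa> p"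
      using r_trace by (simp add: field_simps)
    note XT = vector_fieldsD(1)[OF X, of p] and YT = vector_fieldsD(1)[OF Y, of p]
      and ZT = vector_fieldsD(1)[OF Z, of p]
    define P where "P U = \<mu> p *\<^sub>R h U p + \<nu> p *\<^sub>R \<phi> p (h U p)" for U
    have PT: "P U \<in> ?T" if "U \<in> vector_fields A" for U
      unfolding P_def using vector_fieldsD(1)[OF h_field[OF that]] by (intro lincomb_closed phi_tangent)
    have Pg: "r (U p) (\<xi> p) (\<xi> p) v - \<kappa> p * (g p (U p) v - g p (U p) (\<xi> p) * g p v (\<xi> p)) = g p (P U) v"
      if U: "U \<in> vector_fields A" and v: "v \<in> ?T" for U v
    proof -
      note UT = vector_fieldsD(1)[OF U, of p]
      have d: "U p - \<eta> p (U p) *\<^sub>R \<xi> p \<in> ?T"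
        using UT abz by (intro subspace_diff[OF V] subspace_scale[OF V])
      have "r (U p) (\<xi> p) (\<xi> p) v
          = g p (\<kappa> p *\<^sub>R (U p - \<eta> p (U p) *\<^sub>R \<xi> p) + 1 *\<^sub>R P U) v"
        by (simp add: r_def jacobi_op[OF U] P_def)
      also have "\<dots> = \<kappa> p * g p (U p - \<eta> p (U p) *\<^sub>R \<xi> p) v + 1 * g p (P U) v"
        by (rule lin_left[OF d PT[OF U] v])
      also have "g p (U p - \<eta> p (U p) *\<^sub>R \<xi> p) v = g p (U p) v - g p (U p) (\<xi> p) * g p v (\<xi> p)"
        using UT v abz
        by (simp add: diff_left scale_left subspace_scale[OF V] eta_metric metric_sym[of v p "\<xi> p"])
      finally show ?thesis by simp
    qed
    define \<tau> where "\<tau> = scalar_curvature A g D p"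
    \<comment> \<open>The tensors \<open>R\<^sub>4\<close> and \<open>R\<^sub>7\<close> depend on \<open>h\<close> and \<open>\<phi>h\<close> in the same linear way, so \<open>\<mu> R\<^sub>4 + \<nu> R\<^sub>7\<close>
      is the same expression in \<open>P\<close>.\<close>
    have rhs: "?rhs p = (\<tau> / 2 - 2 * \<kappa> p) *\<^sub>R (g p (Y p) (Z p) *\<^sub>R X p - g p (X p) (Z p) *\<^sub>R Y p)
        + (\<tau> / 2 - 3 * \<kappa> p) *\<^sub>R ((\<eta> p (X p) * \<eta> p (Z p)) *\<^sub>R Y p - (\<eta> p (Y p) * \<eta> p (Z p)) *\<^sub>R X p
            + (g p (X p) (Z p) * \<eta> p (Y p)) *\<^sub>R \<xi> p - (g p (Y p) (Z p) * \<eta> p (X p)) *\<^sub>R \<xi> p)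
        + (g p (Y p) (Z p) *\<^sub>R P X - g p (X p) (Z p) *\<^sub>R P Y
            + g p (P Y) (Z p) *\<^sub>R X p - g p (P X) (Z p) *\<^sub>R Y p)"
    proof -
      have "g p (P U) (Z p) = \<mu> p * g p (h U p) (Z p) + \<nu> p * g p (\<phi> p (h U p)) (Z p)"
        if "U \<in> vector_fields A" for U
        unfolding P_def using vector_fieldsD(1)[OF h_field[OF that], of p] ZT
        by (intro lin_left phi_tangent)
      then show ?thesis
        using X Y
        by (simp add: \<tau>_def R1_def R3_def R4_def R7_def Let_def fscale_apply form1_app_def form2_app_def
            endo_app_def P_def algebra_simps)
    qed
    have rhsT: "?rhs p \<in> ?T"
      unfolding rhs using XT YT PT[OF X] PT[OF Y] abz(3)
      by (intro subspace_add[OF V] subspace_diff[OF V] subspace_scale[OF V])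
    show "curvature D X Y Z p = ?rhs p"
    proof (rule nondegenerate)
      show "curvature D X Y Z p \<in> ?T" by (intro vector_fieldsD(1) vf_curvature X Y Z)
      show "?rhs p \<in> ?T" by (rule rhsT)
      fix w assume w: "w \<in> ?T"
      have "g p (curvature D X Y Z p) w = r (X p) (Y p) (Z p) w"
        by (simp add: r_def curvature_at_eq X Y Z)
      also have "\<dots> = (\<tau> / 2 - 2 * \<kappa> p) * (g p (Y p) (Z p) * g p (X p) w - g p (X p) (Z p) * g p (Y p) w)
          + (\<tau> / 2 - 3 * \<kappa> p) * (g p (X p) (\<xi> p) * g p (Z p) (\<xi> p) * g p (Y p) w
              - g p (Y p) (\<xi> p) * g p (Z p) (\<xi> p) * g p (X p) w
              + g p (X p) (Z p) * g p (Y p) (\<xi> p) * g p w (\<xi> p)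
              - g p (Y p) (Z p) * g p (X p) (\<xi> p) * g p w (\<xi> p))
          + g p (Y p) (Z p) * g p (P X) w - g p (X p) (Z p) * g p (P Y) w
          + g p (P Y) (Z p) * g p (X p) w - g p (P X) (Z p) * g p (Y p) w"
        using curvature_form_dim3[OF B, of r "\<kappa> p", OF r_lin r12 r34 pair r_xi r_trace refl XT YT ZT w]
        by (simp add: Pg X Y ZT w K \<tau>_def)
      also have "\<dots> = g p (?rhs p) w"
        unfolding rhs using XT YT ZT PT[OF X] PT[OF Y] abz(3) w
        by (simp add: add_left diff_left scale_left subspace_add[OF V] subspace_diff[OF V]
            subspace_scale[OF V] eta_metric metric_sym[of w p "\<xi> p"])
      finally show "g p (curvature D X Y Z p) w = g p (?rhs p) w" .
    qed
  qed
qed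

end
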